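(* Let $r\ge 3$, $e\ge 3$, $v\ge r+1$ be fixed integers with $\gcd(e-1,\,er-v)=1$. Then there exist constants $c>0$ and $n_0$ (depending only on $r,e,v$) such that for every $n\ge n_0$ there is an $r$-graph $\mathcal{H}\subseteq\binom{[n]}{r}$ with $$|\mathcal{H}|\ge c\, n^{\frac{er-v}{e-1}}(\log n)^{\frac{1}{e-1}}$$ which is simultaneously $\mathscr{G}_r\!\left(ir-\left\lceil \frac{(i-1)(er-v)}{e-1}\right\rceil,\, i\right)$-free for every $2\le i\le e$. In particular (taking $i=e$), $f_r(n,v,e)=\Omega\big(n^{\frac{er-v}{e-1}}(\log n)^{\frac{1}{e-1}}\big)$ as $n\to\infty$.
   Context: An $r$-graph on vertex set $[n]=\{1,\dots,n\}$ is a family $\mathcal{H}\subseteq\binom{[n]}{r}$ of $r$-element subsets (edges). For integers $w$ and $i\ge 1$, an $r$-graph is called $\mathscr{G}_r(w,i)$-free if the union of any $i$ distinct edges of it contains at least $w+1$ vertices (i.e. no $i$ distinct edges span at most $w$ vertices). $f_r(n,v,e)$ denotes the maximum number of edges of a $\mathscr{G}_r(v,e)$-free $r$-graph on $n$ vertices. $\log$ is the natural logarithm. *)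

theory Defs
  imports Complex_Main
begin

definition r_graph_on :: "nat \<Rightarrow> nat \<Rightarrow> nat set set \<Rightarrow> bool" where
  "r_graph_on r n H \<longleftrightarrow> H \<subseteq> {A. A \<subseteq> {1..n} \<and> card A = r}"

definition G_free :: "nat set set \<Rightarrow> int \<Rightarrow> nat \<Rightarrow> bool" where
  "G_free H w i \<longleftrightarrow> (\<forall>F. F \<subseteq> H \<and> card F = i \<longrightarrow> int (card (\<Union>F)) \<ge> w + 1)"

end

theory Submission
  imports Defs "HOL-Real_Asymp.Real_Asymp"
begin

text \<open>
  Sample every \<open>r\<close>-subset of \<open>[n]\<close> with probability \<open>n\<close> to the power \<open>\<alpha> - r + \<epsilon>\<close>, where
  \<open>\<alpha> = (er - v)/(e - 1)\<close>, and regard the sampled sets as vertices of an \<open>e\<close>-uniform hypergraph whose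
  edges are the \<open>e\<close>-tuples spanning at most \<open>v\<close> points.  Coprimality makes \<open>(i - 1) \<alpha>\<close> non-integral for
  \<open>1 < i < e\<close>, so that all the denser configurations are rare and can be deleted; by submodularity
  of the excess, the absence of dense configurations excludes cycles of length 2, 3 and 4.

  By the theorem of Ajtai, Komlos, Pintz, Spencer and Szemeredi, a hypergraph with \<open>N\<close> vertices,
  edges of size \<open>K + 1\<close>, maximum degree \<open>d\<^sup>K\<close> and no cycles of length 2, 3, 4 has an independent set of
  size of order \<open>(N/d) (log d)\<^sup>1\<^sup>/\<^sup>K\<close>.  It is proved by a nibble in which only upper bounds on the degrees
  are maintained: biased coins make all survival probabilities equal, edges through a vertex behave
  independently, and vertices of too large degree are discarded after Chebyshev's inequality.
  Bounding the expectation of (vertices chosen) + \<open>\<beta>\<close> (vertices left), where \<open>\<beta>\<close> is the density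
  guaranteed for all later rounds, makes concentration of these two numbers unnecessary.
\<close>

section \<open>Expectation over a random subset\<close>

text \<open>Sampling at density n^(\<alpha> - r) and deleting would give only order n^\<alpha>,
  without the logarithm. Oversampling by n^\<epsilon> leaves about n^(\<alpha> + \<epsilon>) sets,
  which lie on average in at most about n^((e-1) \<epsilon>) bad e-tuples. With d of order
  n^\<epsilon> the independent set then has order n^\<alpha> (log d)^(1/(e-1)), and log d is of
  order log n because \<epsilon> is a positive constant. The price is that a family of m sets
  becomes likelier by n^(m \<epsilon>), so only dense families of bounded size can be removed;
  excluding cycles of length 4 requires sizes up to 4e, and this dictates how small \<epsilon> must
  be.

  In the nibble half of the vertices survive each round. After about (log_2 d)/2 rounds all degree
  bounds are still at least of order sqrt d, so a relative Chebyshev error equal to the reciprocal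
  of the number of rounds is affordable, and the errors accumulate to a bounded factor only.\<close>

definition pexp :: "('a \<Rightarrow> real) \<Rightarrow> 'a set \<Rightarrow> ('a set \<Rightarrow> real) \<Rightarrow> real" where
  "pexp p G F = (\<Sum>R\<in>Pow G. (\<Prod>x\<in>R. p x) * (\<Prod>x\<in>G-R. 1 - p x) * F R)"

text \<open>Demanded of every \<open>R\<close>, also outside the ground set, so that the property
  does not refer to \<open>G\<close> and survives the induction on \<open>G\<close> in
  \<open>pexp_indep\<close>.\<close>

definition depends_on :: "('a set \<Rightarrow> real) \<Rightarrow> 'a set \<Rightarrow> bool" where
  "depends_on F A \<longleftrightarrow> (\<forall>R. F R = F (R \<inter> A))"

lemma pexp_cong: "(\<And>R. R \<subseteq> G \<Longrightarrow> F R = H R) \<Longrightarrow> pexp p G F = pexp p G H"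
  unfolding pexp_def by (intro sum.cong) auto

lemma pexp_add: "pexp p G (\<lambda>R. F R + H R) = pexp p G F + pexp p G H"
  unfolding pexp_def by (simp add: algebra_simps sum.distrib)

lemma pexp_diff: "pexp p G (\<lambda>R. F R - H R) = pexp p G F - pexp p G H"
  unfolding pexp_def by (simp add: algebra_simps sum_subtractf)

lemma pexp_cmult: "pexp p G (\<lambda>R. c * F R) = c * pexp p G F"
  unfolding pexp_def by (simp add: sum_distrib_left mult_ac)

lemma pexp_sum: "pexp p G (\<lambda>R. \<Sum>i\<in>I. F i R) = (\<Sum>i\<in>I. pexp p G (F i))"
  unfolding pexp_def by (simp add: sum_distrib_left sum.swap[of _ I])

lemma pexp_insert:
  assumes "finite G" "x \<notin> G"
  shows "pexp p (insert x G) F = (1 - p x) * pexp p G F + p x * pexp p G (\<lambda>R. F (insert x R))"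
proof -
  let ?w = "\<lambda>R. (\<Prod>y\<in>R. p y) * (\<Prod>y\<in>insert x G - R. 1 - p y) * F R"
  have "pexp p (insert x G) F = sum ?w (Pow G) + sum ?w (insert x ` Pow G)"
    unfolding pexp_def Pow_insert using assms by (intro sum.union_disjoint) auto
  also have "sum ?w (Pow G) = (1 - p x) * pexp p G F"
    unfolding pexp_def sum_distrib_left
  proof (rule sum.cong)
    fix R assume "R \<in> Pow G"
    then have "insert x G - R = insert x (G - R)" "x \<notin> G - R" using assms by auto
    then show "?w R = (1 - p x) * ((\<Prod>y\<in>R. p y) * (\<Prod>y\<in>G - R. 1 - p y) * F R)"
      using assms by simp
  qed simp
  also have "sum ?w (insert x ` Pow G) = (\<Sum>R\<in>Pow G. ?w (insert x R))"
  proof (subst sum.reindex)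
    show "inj_on (insert x) (Pow G)" using assms(2) by (intro inj_onI) (metis PowD insert_ident subsetD)
  qed simp
  also have "\<dots> = p x * pexp p G (\<lambda>R. F (insert x R))"
    unfolding pexp_def sum_distrib_left
  proof (rule sum.cong)
    fix R assume R: "R \<in> Pow G"
    then have "insert x G - insert x R = G - R" "x \<notin> R" "finite R"
      using assms finite_subset by auto
    then show "?w (insert x R) = p x * ((\<Prod>y\<in>R. p y) * (\<Prod>y\<in>G - R. 1 - p y) * F (insert x R))"
      by simp
  qed simp
  finally show ?thesis .
qed

lemma pexp_const: "finite G \<Longrightarrow> pexp p G (\<lambda>_. c) = c"
proof (induction G rule: finite_induct)
  case empty
  then show ?case by (simp add: pexp_def)
next
  case (insert x G)
  then show ?case by (simp add: pexp_insert algebra_simps)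
qed

lemma pexp_mono:
  assumes "\<And>x. x \<in> G \<Longrightarrow> 0 \<le> p x \<and> p x \<le> 1" "\<And>R. R \<subseteq> G \<Longrightarrow> F R \<le> H R"
  shows "pexp p G F \<le> pexp p G H"
  unfolding pexp_def
proof (rule sum_mono)
  fix R assume "R \<in> Pow G"
  then show "(\<Prod>x\<in>R. p x) * (\<Prod>x\<in>G - R. 1 - p x) * F R \<le> (\<Prod>x\<in>R. p x) * (\<Prod>x\<in>G - R. 1 - p x) * H R"
    using assms by (intro mult_left_mono mult_nonneg_nonneg prod_nonneg) auto
qed

lemma pexp_exists:
  assumes "finite G" "\<And>x. x \<in> G \<Longrightarrow> 0 \<le> p x \<and> p x \<le> 1" "pexp p G F \<ge> c"
  shows "\<exists>R\<subseteq>G. F R \<ge> c"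
proof (rule ccontr)
  assume "\<not> ?thesis"
  then have *: "F R < c" if "R \<subseteq> G" for R using that by (meson not_le)
  define m where "m = Max (F ` Pow G)"
  have fin: "finite (F ` Pow G)" using assms by simp
  have "m \<in> F ` Pow G" unfolding m_def using fin by (intro Max_in) auto
  then have "m < c" using * by auto
  moreover have "pexp p G F \<le> pexp p G (\<lambda>_. m)"
    using assms fin by (intro pexp_mono) (auto simp: m_def)
  ultimately show False using assms by (simp add: pexp_const)
qed

lemma depends_on_insert:
  assumes "depends_on F A"
  shows "depends_on (\<lambda>R. F (insert x R)) A"
  unfolding depends_on_def
proof
  fix R
  have "F (insert x R) = F (insert x R \<inter> A)" "F (insert x (R \<inter> A)) = F (insert x (R \<inter> A) \<inter> A)"
    using assms unfolding depends_on_def by blast+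
  moreover have "insert x R \<inter> A = insert x (R \<inter> A) \<inter> A" by auto
  ultimately show "F (insert x R) = F (insert x (R \<inter> A))" by simp
qed

lemma depends_on_insert_notin:
  assumes "depends_on F A" "x \<notin> A"
  shows "F (insert x R) = F R"
proof -
  have "F (insert x R) = F (insert x R \<inter> A)" "F R = F (R \<inter> A)"
    using assms unfolding depends_on_def by blast+
  then show ?thesis using assms by simp
qed

lemma depends_on_mono: "depends_on F A \<Longrightarrow> A \<subseteq> B \<Longrightarrow> depends_on F B"
proof -
  assume F: "depends_on F A" and AB: "A \<subseteq> B"
  have "F R = F (R \<inter> B)" for R
  proof -
    have "F R = F (R \<inter> A)" "F (R \<inter> B) = F (R \<inter> B \<inter> A)" using F unfolding depends_on_def by blast+
    moreover have "R \<inter> B \<inter> A = R \<inter> A" using AB by auto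
    ultimately show ?thesis by simp
  qed
  then show ?thesis unfolding depends_on_def by blast
qed

lemma depends_on_prod:
  "(\<And>i. i \<in> I \<Longrightarrow> depends_on (F i) A) \<Longrightarrow> depends_on (\<lambda>R. \<Prod>i\<in>I. F i R) A"
  unfolding depends_on_def by (intro allI prod.cong) blast+

lemma depends_on_mult:
  "depends_on F A \<Longrightarrow> depends_on H A \<Longrightarrow> depends_on (\<lambda>R. F R * H R) A"
  unfolding depends_on_def by metis

text \<open>Condition on one element x at a time: x lies outside \<open>A\<close> or outside
  \<open>B\<close>, so inserting it leaves one of the two factors unchanged, and the average over
  both cases still factors.\<close>

lemma pexp_indep:
  assumes "finite G" "depends_on F A" "depends_on H B" "A \<inter> B = {}"
  shows "pexp p G (\<lambda>R. F R * H R) = pexp p G F * pexp p G H"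
  using assms
proof (induction G arbitrary: F H rule: finite_induct)
  case empty
  then show ?case by (simp add: pexp_def)
next
  case (insert x G)
  note ins = insert.hyps
  have 1: "pexp p G (\<lambda>R. F R * H R) = pexp p G F * pexp p G H" using insert by blast
  have 2: "pexp p G (\<lambda>R. F (insert x R) * H (insert x R))
      = pexp p G (\<lambda>R. F (insert x R)) * pexp p G (\<lambda>R. H (insert x R))"
    using insert by (intro insert.IH depends_on_insert) auto
  have 3: "x \<notin> A \<or> x \<notin> B" using insert by auto
  then have 4: "(\<lambda>R. F (insert x R)) = F \<or> (\<lambda>R. H (insert x R)) = H"
    using depends_on_insert_notin[OF insert.prems(1)] depends_on_insert_notin[OF insert.prems(2)]
    by (auto intro!: ext)
  show ?case unfolding pexp_insert[OF ins] 1 2 using 4 by (auto simp: algebra_simps)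
qed

lemma pexp_indep_prod:
  assumes "finite G" "finite I" "\<And>i. i \<in> I \<Longrightarrow> depends_on (F i) (A i)"
    "\<And>i j. i \<in> I \<Longrightarrow> j \<in> I \<Longrightarrow> i \<noteq> j \<Longrightarrow> A i \<inter> A j = {}"
  shows "pexp p G (\<lambda>R. \<Prod>i\<in>I. F i R) = (\<Prod>i\<in>I. pexp p G (F i))"
  using assms(2-)
proof (induction I rule: finite_induct)
  case empty
  then show ?case using assms(1) by (simp add: pexp_const)
next
  case (insert i I)
  have "pexp p G (\<lambda>R. F i R * (\<Prod>j\<in>I. F j R)) = pexp p G (F i) * pexp p G (\<lambda>R. \<Prod>j\<in>I. F j R)"
  proof (rule pexp_indep[OF assms(1)])
    show "depends_on (F i) (A i)" using insert by auto
    show "depends_on (\<lambda>R. \<Prod>j\<in>I. F j R) (\<Union>j\<in>I. A j)"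
      using insert.prems by (intro depends_on_prod) (auto intro: depends_on_mono)
    have "A i \<inter> A j = {}" if "j \<in> I" for j using insert that by auto
    then show "A i \<inter> (\<Union>j\<in>I. A j) = {}" by blast
  qed
  then show ?case using insert by simp
qed

lemma depends_on_mem: "depends_on (\<lambda>R. of_bool (x \<in> R)) {x}"
  by (simp add: depends_on_def)

lemma pexp_mem:
  assumes "finite G" "x \<in> G"
  shows "pexp p G (\<lambda>R. of_bool (x \<in> R)) = p x"
proof -
  have G: "G = insert x (G - {x})" using assms by auto
  have "pexp p (G - {x}) (\<lambda>R. of_bool (x \<in> R)) = pexp p (G - {x}) (\<lambda>_. 0)"
    by (intro pexp_cong) auto
  then show ?thesis using assms
    by (subst G, subst pexp_insert) (auto simp: pexp_const)
qed

lemma pexp_subset: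
  assumes "finite G" "Y \<subseteq> G"
  shows "pexp p G (\<lambda>R. of_bool (Y \<subseteq> R)) = (\<Prod>y\<in>Y. p y)"
proof -
  have fY: "finite Y" using assms finite_subset by auto
  have "pexp p G (\<lambda>R. of_bool (Y \<subseteq> R)) = pexp p G (\<lambda>R. \<Prod>y\<in>Y. of_bool (y \<in> R))"
  proof (rule pexp_cong)
    show "of_bool (Y \<subseteq> R) = (\<Prod>y\<in>Y. of_bool (y \<in> R) :: real)" for R
      using fY by induction auto
  qed
  also have "\<dots> = (\<Prod>y\<in>Y. pexp p G (\<lambda>R. of_bool (y \<in> R)))"
    using assms fY by (intro pexp_indep_prod[where A = "\<lambda>y. {y}"] depends_on_mem) auto
  also have "\<dots> = (\<Prod>y\<in>Y. p y)"
    using assms by (intro prod.cong pexp_mem) auto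
  finally show ?thesis .
qed

lemma one_minus_sum_le_prod:
  assumes "finite A" "\<And>x. x \<in> A \<Longrightarrow> 0 \<le> f x \<and> f x \<le> (1::real)"
  shows "1 - sum f A \<le> (\<Prod>x\<in>A. 1 - f x)"
  using assms
proof (induction A rule: finite_induct)
  case (insert x A)
  have "1 - sum f A \<le> (\<Prod>x\<in>A. 1 - f x)" "f x \<ge> 0" "f x \<le> 1" "sum f A \<ge> 0"
    using insert by (auto intro: sum_nonneg)
  then have "(1 - f x) * (1 - sum f A) \<le> (1 - f x) * (\<Prod>x\<in>A. 1 - f x)" "f x * sum f A \<ge> 0"
    by (auto intro: mult_left_mono)
  then show ?case using insert by (simp add: algebra_simps)
qed simp

text \<open>Chebyshev's inequality: the variance of a sum of pairwise independent indicators is at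
  most its mean.\<close>
lemma pexp_indicator_sum_tail:
  assumes fin: "finite G" "finite A"
    and p: "\<And>x. x \<in> G \<Longrightarrow> 0 \<le> p x \<and> p x \<le> 1"
    and Y: "\<And>a R. a \<in> A \<Longrightarrow> Y a R \<in> {0, 1::real}"
    and ind: "\<And>a b. a \<in> A \<Longrightarrow> b \<in> A \<Longrightarrow> a \<noteq> b \<Longrightarrow>
      pexp p G (\<lambda>R. Y a R * Y b R) = pexp p G (Y a) * pexp p G (Y b)"
    and mu: "(\<Sum>a\<in>A. pexp p G (Y a)) \<le> M" and pos: "\<delta> > 0" "M > 0"
  shows "pexp p G (\<lambda>R. of_bool ((\<Sum>a\<in>A. Y a R) > (1 + \<delta>) * M)) \<le> 1 / (\<delta>\<^sup>2 * M)"
proof -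
  define X where "X R = (\<Sum>a\<in>A. Y a R)" for R
  define \<mu> where "\<mu> = (\<Sum>a\<in>A. pexp p G (Y a))"
  define y where "y a = pexp p G (Y a)" for a
  have EX: "pexp p G X = \<mu>" unfolding X_def \<mu>_def by (rule pexp_sum)
  have sq: "pexp p G (\<lambda>R. Y a R * Y a R) = y a" if "a \<in> A" for a
    unfolding y_def using Y[OF that] by (intro pexp_cong) auto
  have "pexp p G (\<lambda>R. X R * X R) = (\<Sum>a\<in>A. \<Sum>b\<in>A. pexp p G (\<lambda>R. Y a R * Y b R))"
    unfolding X_def sum_product by (simp add: pexp_sum)
  also have "\<dots> \<le> (\<Sum>a\<in>A. \<Sum>b\<in>A. y a * y b + (if a = b then y a else 0))"
  proof (intro sum_mono)
    fix a b assume "a \<in> A" "b \<in> A"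
    then show "pexp p G (\<lambda>R. Y a R * Y b R) \<le> y a * y b + (if a = b then y a else 0)"
      using ind[of a b] sq[of a] by (cases "a = b") (auto simp: y_def)
  qed
  also have "\<dots> = \<mu> * \<mu> + \<mu>"
    using fin by (simp add: sum.distrib \<mu>_def y_def sum_product)
  finally have "pexp p G (\<lambda>R. X R * X R) \<le> \<mu> * \<mu> + \<mu>" .
  moreover have "pexp p G (\<lambda>R. (X R - \<mu>) * (X R - \<mu>)) =
     pexp p G (\<lambda>R. X R * X R) - 2 * \<mu> * pexp p G X + \<mu> * \<mu>"
  proof -
    have "(\<lambda>R. (X R - \<mu>) * (X R - \<mu>)) = (\<lambda>R. (X R * X R - (2 * \<mu>) * X R) + \<mu> * \<mu>)"
      by (rule ext) (simp add: algebra_simps)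
    then show ?thesis by (simp add: pexp_add pexp_diff pexp_cmult pexp_const fin)
  qed
  ultimately have var: "pexp p G (\<lambda>R. (X R - \<mu>) * (X R - \<mu>)) \<le> M"
    using EX mu by (simp add: \<mu>_def)
  have "(\<delta> * M)\<^sup>2 * pexp p G (\<lambda>R. of_bool (X R > (1 + \<delta>) * M))
      = pexp p G (\<lambda>R. (\<delta> * M)\<^sup>2 * of_bool (X R > (1 + \<delta>) * M))"
    by (simp add: pexp_cmult)
  also have "\<dots> \<le> pexp p G (\<lambda>R. (X R - \<mu>) * (X R - \<mu>))"
  proof (rule pexp_mono[OF p])
    fix R
    have "(\<delta> * M)\<^sup>2 \<le> (X R - \<mu>)\<^sup>2" if "X R > (1 + \<delta>) * M"
      using that mu pos by (intro power_mono) (auto simp: \<mu>_def algebra_simps)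
    then show "(\<delta> * M)\<^sup>2 * of_bool (X R > (1 + \<delta>) * M) \<le> (X R - \<mu>) * (X R - \<mu>)"
      by (auto simp: power2_eq_square)
  qed
  also note var
  finally have "pexp p G (\<lambda>R. of_bool (X R > (1 + \<delta>) * M)) \<le> M / (\<delta> * M)\<^sup>2"
    using pos by (simp add: pos_le_divide_eq mult.commute)
  also have "\<dots> = 1 / (\<delta>\<^sup>2 * M)" using pos by (simp add: power2_eq_square)
  finally show ?thesis unfolding X_def .
qed

section \<open>Independent sets in uncrowded hypergraphs\<close>

text \<open>These are Berge cycles of lengths 2, 3 and 4. Each length yields one independence in the
  nibble: 2 for the edges that may block a vertex, 3 for the vertices of one edge, 4 for the edges
  through one vertex.\<close>

definition uncrowded :: "'a set set \<Rightarrow> bool" where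
  "uncrowded E \<longleftrightarrow>
    (\<forall>e\<in>E. \<forall>f\<in>E. \<forall>x y. x \<noteq> y \<and> {x, y} \<subseteq> e \<inter> f \<longrightarrow> e = f) \<and>
    (\<forall>e\<in>E. \<forall>f\<in>E. \<forall>g\<in>E. \<forall>x y z. distinct [e, f, g] \<and> distinct [x, y, z] \<longrightarrow>
      \<not> ({x, y} \<subseteq> e \<and> {y, z} \<subseteq> f \<and> {z, x} \<subseteq> g)) \<and>
    (\<forall>e\<in>E. \<forall>f\<in>E. \<forall>g\<in>E. \<forall>h\<in>E. \<forall>x y z w. distinct [e, f, g, h] \<and> distinct [x, y, z, w] \<longrightarrow>
      \<not> ({x, y} \<subseteq> e \<and> {y, z} \<subseteq> f \<and> {z, w} \<subseteq> g \<and> {w, x} \<subseteq> h))"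

lemma uncrowded_linear:
  assumes "uncrowded E" "e \<in> E" "f \<in> E" "x \<in> e" "x \<in> f" "y \<in> e" "y \<in> f" "x \<noteq> y"
  shows "e = f"
proof -
  have "\<forall>x y. x \<noteq> y \<and> {x, y} \<subseteq> e \<inter> f \<longrightarrow> e = f"
    by (rule bspec[OF bspec[OF conjunct1[OF assms(1)[unfolded uncrowded_def]] assms(2)] assms(3)])
  then show ?thesis using assms(4-) by (elim allE[of _ x] allE[of _ y]) auto
qed

lemma uncrowded_triangle:
  "uncrowded E \<Longrightarrow> e \<in> E \<Longrightarrow> f \<in> E \<Longrightarrow> g \<in> E \<Longrightarrow> distinct [e, f, g] \<Longrightarrow> distinct [x, y, z] \<Longrightarrow>
   {x, y} \<subseteq> e \<Longrightarrow> {y, z} \<subseteq> f \<Longrightarrow> {z, x} \<subseteq> g \<Longrightarrow> False"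
  unfolding uncrowded_def by blast

lemma uncrowded_quadrangle:
  "uncrowded E \<Longrightarrow> e \<in> E \<Longrightarrow> f \<in> E \<Longrightarrow> g \<in> E \<Longrightarrow> h \<in> E \<Longrightarrow> distinct [e, f, g, h] \<Longrightarrow>
   distinct [x, y, z, w] \<Longrightarrow> {x, y} \<subseteq> e \<Longrightarrow> {y, z} \<subseteq> f \<Longrightarrow> {z, w} \<subseteq> g \<Longrightarrow> {w, x} \<subseteq> h \<Longrightarrow> False"
  unfolding uncrowded_def by blast

text \<open>Needed because chosen vertices are removed from the edges. Different traces come from
  different edges, and an edge contains its trace, so a short cycle of traces lifts to one in
  \<open>E\<close>.\<close>

lemma uncrowded_trace:
  assumes "uncrowded E" and sub: "\<And>g. g \<in> E' \<Longrightarrow> \<exists>e\<in>E. g = e - I"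
  shows "uncrowded E'"
proof -
  define \<phi> where "\<phi> g = (SOME e. e \<in> E \<and> g = e - I)" for g
  have \<phi>: "\<phi> g \<in> E" "g = \<phi> g - I" if "g \<in> E'" for g
  proof -
    have "\<exists>e. e \<in> E \<and> g = e - I" using sub[OF that] by blast
    from someI_ex[OF this] show "\<phi> g \<in> E" "g = \<phi> g - I" unfolding \<phi>_def by auto
  qed
  have inj: "\<phi> g \<noteq> \<phi> h" if "g \<in> E'" "h \<in> E'" "g \<noteq> h" for g h
    using that \<phi> by metis
  then have injE: "inj_on \<phi> E'" by (meson inj_onI)
  have sb: "g \<subseteq> \<phi> g" if "g \<in> E'" for g using \<phi>(2)[OF that] by blast
  show ?thesis unfolding uncrowded_def
  proof (intro conjI ballI allI impI)
    fix e f x y assume *: "e \<in> E'" "f \<in> E'" "x \<noteq> y \<and> {x, y} \<subseteq> e \<inter> f"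
    then have "\<phi> e = \<phi> f"
      using sb[of e] sb[of f] by (intro uncrowded_linear[OF assms(1), of _ _ x y] \<phi>) auto
    then show "e = f" using inj * by blast
  next
    fix e f g and x y z :: 'a
    assume *: "e \<in> E'" "f \<in> E'" "g \<in> E'" "distinct [e, f, g] \<and> distinct [x, y, z]"
    show "\<not> ({x, y} \<subseteq> e \<and> {y, z} \<subseteq> f \<and> {z, x} \<subseteq> g)"
    proof
      assume **: "{x, y} \<subseteq> e \<and> {y, z} \<subseteq> f \<and> {z, x} \<subseteq> g"
      have d: "distinct [\<phi> e, \<phi> f, \<phi> g]" "distinct [x, y, z]"
        using *(4) distinct_map[of \<phi> "[e, f, g]"] inj_on_subset[OF injE, of "set [e, f, g]"] *(1-3)
        by simp_all
      have "{x, y} \<subseteq> \<phi> e" "{y, z} \<subseteq> \<phi> f" "{z, x} \<subseteq> \<phi> g"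
        using ** sb[OF *(1)] sb[OF *(2)] sb[OF *(3)] by (meson subset_trans)+
      then show False
        by (rule uncrowded_triangle[OF assms(1) \<phi>(1)[OF *(1)] \<phi>(1)[OF *(2)] \<phi>(1)[OF *(3)] d])
    qed
  next
    fix e f g h and x y z w :: 'a
    assume *: "e \<in> E'" "f \<in> E'" "g \<in> E'" "h \<in> E'" "distinct [e, f, g, h] \<and> distinct [x, y, z, w]"
    show "\<not> ({x, y} \<subseteq> e \<and> {y, z} \<subseteq> f \<and> {z, w} \<subseteq> g \<and> {w, x} \<subseteq> h)"
    proof
      assume **: "{x, y} \<subseteq> e \<and> {y, z} \<subseteq> f \<and> {z, w} \<subseteq> g \<and> {w, x} \<subseteq> h"
      have d: "distinct [\<phi> e, \<phi> f, \<phi> g, \<phi> h]" "distinct [x, y, z, w]"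
        using *(5) distinct_map[of \<phi> "[e, f, g, h]"] inj_on_subset[OF injE, of "set [e, f, g, h]"] *(1-4)
        by simp_all
      have "{x, y} \<subseteq> \<phi> e" "{y, z} \<subseteq> \<phi> f" "{z, w} \<subseteq> \<phi> g" "{w, x} \<subseteq> \<phi> h"
        using ** sb[OF *(1)] sb[OF *(2)] sb[OF *(3)] sb[OF *(4)] by (meson subset_trans)+
      then show False
        using d uncrowded_quadrangle[OF assms(1) \<phi>(1)[OF *(1)] \<phi>(1)[OF *(2)]
              \<phi>(1)[OF *(3)] \<phi>(1)[OF *(4)]] by metis
    qed
  qed
qed

text \<open>Edges of cardinality \<open>j + 1\<close> are indexed by \<open>j\<close>, the exponent with which they
  enter the generating polynomial of the degrees.\<close>
definition sparse_hypergraph :: "nat \<Rightarrow> (nat \<Rightarrow> real) \<Rightarrow> 'a set \<Rightarrow> 'a set set \<Rightarrow> bool" where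
  "sparse_hypergraph K B V E \<longleftrightarrow> finite V \<and> uncrowded E \<and>
    (\<forall>e\<in>E. e \<subseteq> V \<and> 2 \<le> card e \<and> card e \<le> Suc K) \<and>
    (\<forall>u\<in>V. \<forall>j\<in>{1..K}. real (card {e\<in>E. u \<in> e \<and> card e = Suc j}) \<le> B j)"

definition indep_set :: "'a set set \<Rightarrow> 'a set \<Rightarrow> bool" where
  "indep_set E J \<longleftrightarrow> (\<forall>e\<in>E. \<not> e \<subseteq> J)"

text \<open>One round of the nibble.  A vertex \<open>w\<close> is selected if \<open>Inl w\<close> lies in the random set; the
  coin \<open>Inr w\<close> is biased so that every vertex survives with probability exactly \<open>1/2\<close>, whatever
  its degrees are.\<close>
locale nibble =
  fixes K :: nat and B :: "nat \<Rightarrow> real" and V :: "'a set" and E :: "'a set set" and p :: real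
  assumes sparse: "sparse_hypergraph K B V E"
    and p: "0 \<le> p" "p < 1"
    and kill: "(\<Sum>j=1..K. B j * p ^ j) \<le> 1 / 2"
begin

section \<open>Survival probabilities in one round\<close>

lemma finV: "finite V" and unc: "uncrowded E"
  and edge: "\<And>e. e \<in> E \<Longrightarrow> e \<subseteq> V" "\<And>e. e \<in> E \<Longrightarrow> 2 \<le> card e" "\<And>e. e \<in> E \<Longrightarrow> card e \<le> Suc K"
  and deg: "\<And>u j. u \<in> V \<Longrightarrow> j \<in> {1..K} \<Longrightarrow> real (card {e\<in>E. u \<in> e \<and> card e = Suc j}) \<le> B j"
  using sparse unfolding sparse_hypergraph_def by auto

lemmas linear = uncrowded_linear[OF unc]

lemma finE: "finite E"
  using edge(1) finV by (meson finite_Pow_iff finite_subset PowI subsetI)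

lemma fin_edge: "e \<in> E \<Longrightarrow> finite e"
  using edge(1) finV finite_subset by blast

definition G :: "('a + 'a) set" where "G = Inl ` V \<union> Inr ` V"

text \<open>The denominator is the probability that no edge blocks \<open>w\<close>. By
  \<open>kill\<close> it is at least 1/2 (see \<open>prod_ge_half\<close>), so the quotient is at
  most 1 and a legitimate probability.\<close>

definition alive :: "'a \<Rightarrow> real" where
  "alive w = (1 / 2) / (\<Prod>f\<in>{f\<in>E. w \<in> f}. 1 - p ^ (card f - 1))"

definition pr :: "'a + 'a \<Rightarrow> real" where "pr = case_sum (\<lambda>_. p) alive"

abbreviation ex :: "(('a + 'a) set \<Rightarrow> real) \<Rightarrow> real" where "ex \<equiv> pexp pr G"

text \<open>A vertex is blocked by an edge whose other vertices are all selected, whether or not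
  these survive. The parameter \<open>F\<close> allows one edge \<open>e\<close> to be ignored:
  blocking through \<open>e\<close> itself would make the vertices of \<open>e\<close>
  dependent.\<close>

definition surv :: "'a set set \<Rightarrow> 'a \<Rightarrow> ('a + 'a) set \<Rightarrow> real" where
  "surv F w R = of_bool (Inr w \<in> R) * (\<Prod>f\<in>{f\<in>F. w \<in> f}. 1 - of_bool (Inl ` (f - {w}) \<subseteq> R))"

lemma finG: "finite G" unfolding G_def using finV by simp

lemma pow_lt_1: "e \<in> E \<Longrightarrow> p ^ (card e - 1) < 1"
  using edge(2)[of e] p by (simp add: power_less_one_iff)

lemma prod_ge_half:
  assumes "w \<in> V"
  shows "(\<Prod>f\<in>{f\<in>E. w \<in> f}. 1 - p ^ (card f - 1)) \<ge> 1 / 2"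
proof -
  let ?F = "{f\<in>E. w \<in> f}"
  have "(\<Sum>f\<in>?F. p ^ (card f - 1)) = (\<Sum>j\<in>{1..K}. \<Sum>f\<in>{f\<in>?F. card f - 1 = j}. p ^ (card f - 1))"
    using finE edge by (intro sum.group[symmetric]) (auto simp: le_diff_conv, force)
  also have "\<dots> \<le> (\<Sum>j\<in>{1..K}. B j * p ^ j)"
  proof (intro sum_mono)
    fix j assume j: "j \<in> {1..K}"
    have eq: "{f\<in>?F. card f - 1 = j} = {f\<in>E. w \<in> f \<and> card f = Suc j}"
      using edge(2) j by force
    have "(\<Sum>f\<in>{f\<in>?F. card f - 1 = j}. p ^ (card f - 1)) = (\<Sum>f\<in>{f\<in>?F. card f - 1 = j}. p ^ j)"
      by (intro sum.cong) auto
    also have "\<dots> = real (card {f\<in>E. w \<in> f \<and> card f = Suc j}) * p ^ j" by (simp only: sum_constant eq)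
    also have "\<dots> \<le> B j * p ^ j" using deg[OF assms j] p by (intro mult_right_mono) auto
    finally show "(\<Sum>f\<in>{f\<in>?F. card f - 1 = j}. p ^ (card f - 1)) \<le> B j * p ^ j" .
  qed
  also note kill
  finally have "1 / 2 \<le> 1 - (\<Sum>f\<in>?F. p ^ (card f - 1))" by simp
  also have "\<dots> \<le> (\<Prod>f\<in>?F. 1 - p ^ (card f - 1))"
    using finE p by (intro one_minus_sum_le_prod) (auto simp: power_le_one)
  finally show ?thesis .
qed

lemma pr_bounds: "x \<in> G \<Longrightarrow> 0 \<le> pr x \<and> pr x \<le> 1"
  using prod_ge_half p unfolding G_def pr_def alive_def by (fastforce simp: field_simps)

lemma ex_in: "w \<in> V \<Longrightarrow> ex (\<lambda>R. of_bool (Inl w \<in> R)) = p"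
  by (subst pexp_mem) (auto simp: finV G_def pr_def)

lemma ex_blocked:
  assumes "f \<subseteq> V"
  shows "ex (\<lambda>R. of_bool (Inl ` f \<subseteq> R)) = p ^ card f"
proof -
  have "ex (\<lambda>R. of_bool (Inl ` f \<subseteq> R)) = (\<Prod>y\<in>Inl ` f. pr y)"
    using assms by (intro pexp_subset finG) (auto simp: G_def)
  also have "\<dots> = p ^ card f" by (subst prod.reindex) (auto simp: pr_def)
  finally show ?thesis .
qed

lemma depends_surv: "depends_on (surv F w) ({Inr w} \<union> Inl ` (\<Union>{f\<in>F. w \<in> f} - {w}))"
  unfolding surv_def
proof (intro depends_on_mult depends_on_prod)
  show "depends_on (\<lambda>R. of_bool (Inr w \<in> R)) ({Inr w} \<union> Inl ` (\<Union>{f\<in>F. w \<in> f} - {w}))"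
    by (rule depends_on_mono[OF depends_on_mem]) auto
next
  fix f assume f: "f \<in> {f\<in>F. w \<in> f}"
  have "depends_on (\<lambda>R. 1 - of_bool (Inl ` (f - {w}) \<subseteq> R)) (Inl ` (f - {w}))"
    unfolding depends_on_def by auto
  then show "depends_on (\<lambda>R. 1 - of_bool (Inl ` (f - {w}) \<subseteq> R)) ({Inr w} \<union> Inl ` (\<Union>{f\<in>F. w \<in> f} - {w}))"
    by (rule depends_on_mono) (use f in blast)
qed

text \<open>The coin is independent of all selections, and by linearity the edges through
  \<open>w\<close> are disjoint apart from \<open>w\<close>, so the blocking events are independent
  too.\<close>

lemma ex_surv_general:
  assumes "w \<in> V" "F \<subseteq> E"
  shows "ex (surv F w) = alive w * (\<Prod>f\<in>{f\<in>F. w \<in> f}. 1 - p ^ (card f - 1))"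
proof -
  let ?b = "\<lambda>f R. 1 - of_bool (Inl ` (f - {w}) \<subseteq> R) :: real"
  have dep: "depends_on (?b f) (Inl ` (f - {w}))" for f
    unfolding depends_on_def by auto
  have "ex (surv F w) = ex (\<lambda>R. of_bool (Inr w \<in> R)) * ex (\<lambda>R. \<Prod>f\<in>{f\<in>F. w \<in> f}. ?b f R)"
    unfolding surv_def
  proof (rule pexp_indep[OF finG depends_on_mem])
    show "depends_on (\<lambda>R. \<Prod>f\<in>{f\<in>F. w \<in> f}. ?b f R) (range Inl)"
      by (intro depends_on_prod depends_on_mono[OF dep]) auto
  qed auto
  also have "ex (\<lambda>R. of_bool (Inr w \<in> R)) = alive w"
    using assms by (subst pexp_mem) (auto simp: finV G_def pr_def)
  also have "ex (\<lambda>R. \<Prod>f\<in>{f\<in>F. w \<in> f}. ?b f R) = (\<Prod>f\<in>{f\<in>F. w \<in> f}. ex (?b f))"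
  proof (rule pexp_indep_prod[OF finG _ dep])
    show "finite {f\<in>F. w \<in> f}" using finite_subset[OF assms(2) finE] by simp
    fix f g assume "f \<in> {f\<in>F. w \<in> f}" "g \<in> {f\<in>F. w \<in> f}" "f \<noteq> g"
    then show "Inl ` (f - {w}) \<inter> Inl ` (g - {w}) = {}"
      using linear[of f g w] assms by auto
  qed
  also have "\<dots> = (\<Prod>f\<in>{f\<in>F. w \<in> f}. 1 - p ^ (card f - 1))"
  proof (intro prod.cong refl)
    fix f assume f: "f \<in> {f\<in>F. w \<in> f}"
    then have "card (f - {w}) = card f - 1" by (intro card_Diff_singleton) auto
    moreover have "f - {w} \<subseteq> V" using f assms edge(1)[of f] by auto
    ultimately show "ex (?b f) = 1 - p ^ (card f - 1)"
      by (simp add: pexp_diff pexp_const finG ex_blocked)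
  qed
  finally show ?thesis .
qed

lemma ex_surv: "w \<in> V \<Longrightarrow> ex (surv E w) = 1 / 2"
  using prod_ge_half[of w] by (simp add: ex_surv_general alive_def)

lemma ex_surv_del:
  assumes "e \<in> E" "w \<in> e"
  shows "ex (surv (E - {e}) w) = (1 / 2) / (1 - p ^ (card e - 1))"
proof -
  have w: "w \<in> V" using assms edge(1) by auto
  have eq: "{f\<in>E. w \<in> f} = insert e {f\<in>E - {e}. w \<in> f}" using assms by auto
  have "(\<Prod>f\<in>{f\<in>E. w \<in> f}. 1 - p ^ (card f - 1)) =
    (1 - p ^ (card e - 1)) * (\<Prod>f\<in>{f\<in>E - {e}. w \<in> f}. 1 - p ^ (card f - 1))"
    unfolding eq using finE by (subst prod.insert) auto
  moreover have "(\<Prod>f\<in>{f\<in>E. w \<in> f}. 1 - p ^ (card f - 1)) \<noteq> 0" using prod_ge_half[OF w] by auto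
  moreover have "1 - p ^ (card e - 1) \<noteq> 0" using pow_lt_1[OF assms(1)] by auto
  ultimately show ?thesis using w by (simp add: ex_surv_general alive_def)
qed

lemma surv_01: "surv F w R \<in> {0, 1}"
proof -
  have "(\<Prod>f\<in>A. 1 - of_bool (P f)) \<in> {0, 1::real}" for A :: "'a set set" and P
    by (induction A rule: infinite_finite_induct) auto
  from this[where A = "{f\<in>F. w \<in> f}" and P = "\<lambda>f. Inl ` (f - {w}) \<subseteq> R"]
  show ?thesis unfolding surv_def by auto
qed

lemma surv_antimono:
  assumes "surv F w R = 1" "F' \<subseteq> F" "finite F"
  shows "surv F' w R = 1"
proof -
  have "(\<Prod>f\<in>{f\<in>F. w \<in> f}. 1 - of_bool (Inl ` (f - {w}) \<subseteq> R)) \<noteq> (0::real)" "Inr w \<in> R"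
    using assms(1) unfolding surv_def by (auto simp: of_bool_def split: if_splits)
  then have "\<forall>f\<in>{f\<in>F. w \<in> f}. \<not> Inl ` (f - {w}) \<subseteq> R"
    using assms(3) by (subst (asm) prod_zero_iff) auto
  then have "(\<Prod>f\<in>{f\<in>F'. w \<in> f}. 1 - of_bool (Inl ` (f - {w}) \<subseteq> R)) = (\<Prod>f\<in>{f\<in>F'. w \<in> f}. (1::real))"
    using assms(2) by (intro prod.cong) auto
  then show ?thesis unfolding surv_def using \<open>Inr w \<in> R\<close> by simp
qed

lemma surv_blocked:
  assumes "surv E w R = 1" "f \<in> E" "w \<in> f"
  shows "\<not> Inl ` (f - {w}) \<subseteq> R"
proof
  assume "Inl ` (f - {w}) \<subseteq> R"
  then have "(\<Prod>f\<in>{f\<in>E. w \<in> f}. 1 - of_bool (Inl ` (f - {w}) \<subseteq> R)) = (0::real)"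
    using assms finE by (intro prod_zero) (auto intro!: bexI[of _ f])
  then show False using assms(1) unfolding surv_def by simp
qed

section \<open>Disjoint neighbourhoods from the absence of short cycles\<close>

definition nbh :: "'a set \<Rightarrow> 'a \<Rightarrow> 'a set" where
  "nbh e w = insert w (\<Union>{f\<in>E - {e}. w \<in> f})"

lemma nbh_edge: "e \<in> E \<Longrightarrow> w \<in> e \<Longrightarrow> x \<in> nbh e w \<Longrightarrow> x \<in> e \<Longrightarrow> x = w"
  unfolding nbh_def using linear by blast

text \<open>A common point would close a triangle formed by \<open>e\<close>, an edge at
  \<open>w\<close> and an edge at \<open>w'\<close>. Hence the fates of different vertices of
  \<open>e\<close> are independent once \<open>e\<close> is ignored.\<close>

lemma nbh_disjoint_same:
  assumes "e \<in> E" "w \<in> e" "w' \<in> e" "w \<noteq> w'"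
  shows "nbh e w \<inter> nbh e w' = {}"
proof (rule ccontr)
  assume "\<not> ?thesis"
  then obtain x where x: "x \<in> nbh e w" "x \<in> nbh e w'" by auto
  then have "x \<noteq> w" "x \<noteq> w'" using nbh_edge assms by blast+
  then obtain f g where f: "f \<in> E" "f \<noteq> e" "w \<in> f" "x \<in> f" and g: "g \<in> E" "g \<noteq> e" "w' \<in> g" "x \<in> g"
    using x unfolding nbh_def by auto
  have "f \<noteq> g" using linear[of e f w w'] assms f g by auto
  then show False
    using uncrowded_triangle[OF unc, of e f g w' w x]
      uncrowded_triangle[OF unc, of e g f w w' x] assms f g \<open>x \<noteq> w\<close> \<open>x \<noteq> w'\<close> by auto
qed

text \<open>A common point \<open>x\<close> would close a cycle of length 4 through
  \<open>u\<close>, \<open>w\<close>, \<open>x\<close>, \<open>w'\<close>. The degenerate positions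
  give an edge joining \<open>w\<close> and \<open>w'\<close>, hence a triangle.\<close>

lemma nbh_disjoint_other:
  assumes e: "e \<in> E" "u \<in> e" "w \<in> e" "w \<noteq> u" and e': "e' \<in> E" "u \<in> e'" "w' \<in> e'" "w' \<noteq> u"
    and "e \<noteq> e'"
  shows "nbh e w \<inter> nbh e' w' = {}"
proof (rule ccontr)
  assume "\<not> ?thesis"
  then obtain x where x: "x \<in> nbh e w" "x \<in> nbh e' w'" by auto
  have w: "w \<notin> e'" "w' \<notin> e" "w \<noteq> w'"
    using linear[of e e' u w] linear[of e e' u w'] assms by auto
  have xu: "x \<noteq> u" using nbh_edge[OF e(1,3) x(1)] e by auto
  have ge: False if "g \<in> E" "w \<in> g" "w' \<in> g" for g
  proof -
    have "g \<noteq> e" "g \<noteq> e'" using that w by auto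
    then show False
      using uncrowded_triangle[OF unc, of e g e' u w w'] that assms w by auto
  qed
  have xw': "x \<noteq> w'" using x(1) w ge unfolding nbh_def by auto
  have xw: "x \<noteq> w" using x(2) w ge unfolding nbh_def by auto
  obtain f g where f: "f \<in> E" "f \<noteq> e" "w \<in> f" "x \<in> f" and g: "g \<in> E" "g \<noteq> e'" "w' \<in> g" "x \<in> g"
    using x xw xw' unfolding nbh_def by auto
  have "f \<noteq> g" "f \<noteq> e'" "g \<noteq> e" using ge f g w by auto
  then show False
    using uncrowded_quadrangle[OF unc, of e f g e' u w x w'] assms f g w xu xw xw' by auto
qed

text \<open>\<open>partial e u i\<close> indicates that \<open>e\<close> contributes an edge with \<open>i\<close> further vertices to the new
  neighbourhood of \<open>u\<close>.\<close>
definition partial :: "'a set \<Rightarrow> 'a \<Rightarrow> nat \<Rightarrow> ('a + 'a) set \<Rightarrow> real" where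
  "partial e u i R = of_bool (card {w\<in>e - {u}. Inl w \<in> R} = card e - 1 - i \<and>
     (\<forall>w\<in>e - {u}. Inl w \<notin> R \<longrightarrow> surv (E - {e}) w R = 1))"

lemma depends_surv_nbh: "depends_on (surv (E - {e}) w) ({Inr w} \<union> Inl ` nbh e w)"
  by (rule depends_on_mono[OF depends_surv]) (auto simp: nbh_def)

lemma depends_partial:
  "depends_on (partial e u i) (\<Union>w\<in>e - {u}. {Inr w} \<union> Inl ` nbh e w)" (is "depends_on _ ?A")
  unfolding depends_on_def
proof
  fix R
  have 1: "Inl w \<in> R \<longleftrightarrow> Inl w \<in> R \<inter> ?A" if "w \<in> e - {u}" for w
    using that unfolding nbh_def by auto
  have 2: "surv (E - {e}) w R = surv (E - {e}) w (R \<inter> ?A)" if "w \<in> e - {u}" for w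
  proof -
    have "depends_on (surv (E - {e}) w) ?A"
      by (rule depends_on_mono[OF depends_surv_nbh]) (use that in auto)
    then show ?thesis unfolding depends_on_def by blast
  qed
  have "{w\<in>e - {u}. Inl w \<in> R} = {w\<in>e - {u}. Inl w \<in> R \<inter> ?A}" using 1 by blast
  moreover have "(\<forall>w\<in>e - {u}. Inl w \<notin> R \<longrightarrow> surv (E - {e}) w R = 1) \<longleftrightarrow>
    (\<forall>w\<in>e - {u}. Inl w \<notin> R \<inter> ?A \<longrightarrow> surv (E - {e}) w (R \<inter> ?A) = 1)" using 1 2 by auto
  ultimately show "partial e u i R = partial e u i (R \<inter> ?A)" unfolding partial_def by simp
qed

text \<open>Pairwise independence of the contributions to one degree, as required for Chebyshev's
  inequality.\<close>

lemma partial_indep: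
  assumes "e \<in> E" "e' \<in> E" "e \<noteq> e'" "u \<in> e" "u \<in> e'"
  shows "ex (\<lambda>R. partial e u i R * partial e' u i R) = ex (partial e u i) * ex (partial e' u i)"
proof (rule pexp_indep[OF finG depends_partial depends_partial])
  have "({Inr w} \<union> Inl ` nbh e w) \<inter> ({Inr w'} \<union> Inl ` nbh e' w') = {}"
    if "w \<in> e - {u}" "w' \<in> e' - {u}" for w w'
  proof -
    have "nbh e w \<inter> nbh e' w' = {}" using nbh_disjoint_other[of e u w e' w'] assms that by auto
    moreover from this have "w \<noteq> w'" unfolding nbh_def by auto
    ultimately show ?thesis by auto
  qed
  then show "(\<Union>w\<in>e - {u}. {Inr w} \<union> Inl ` nbh e w) \<inter> (\<Union>w\<in>e' - {u}. {Inr w} \<union> Inl ` nbh e' w) = {}"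
    by blast
qed

text \<open>Once the selected set \<open>T\<close> is fixed, the other vertices of \<open>e\<close>
  apart from \<open>u\<close> have disjoint neighbourhoods, which also avoid \<open>T\<close>, so
  all factors are independent.\<close>

lemma ex_partial_term:
  assumes e: "e \<in> E" "u \<in> e" and T: "T \<subseteq> e - {u}"
  shows "ex (\<lambda>R. of_bool (Inl ` T \<subseteq> R) *
      (\<Prod>w\<in>e - {u} - T. (1 - of_bool (Inl w \<in> R)) * surv (E - {e}) w R))
    \<le> p ^ card T * (1 / 2) ^ (card (e - {u} - T))"
proof -
  let ?q = "\<lambda>w R. (1 - of_bool (Inl w \<in> R)) * surv (E - {e}) w R"
  let ?A = "\<lambda>w. {Inr w} \<union> Inl ` nbh e w :: ('a + 'a) set"
  have dep: "depends_on (?q w) (?A w)" for w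
  proof (rule depends_on_mult[OF _ depends_surv_nbh])
    show "depends_on (\<lambda>R. 1 - of_bool (Inl w \<in> R)) (?A w)"
      unfolding depends_on_def nbh_def by auto
  qed
  have disj: "?A w \<inter> ?A w' = {}" if "w \<in> e" "w' \<in> e" "w \<noteq> w'" for w w'
    using nbh_disjoint_same[OF e(1) that] that by auto
  have "ex (\<lambda>R. of_bool (Inl ` T \<subseteq> R) * (\<Prod>w\<in>e - {u} - T. ?q w R))
     = ex (\<lambda>R. of_bool (Inl ` T \<subseteq> R)) * ex (\<lambda>R. \<Prod>w\<in>e - {u} - T. ?q w R)"
  proof (rule pexp_indep[OF finG])
    show "depends_on (\<lambda>R. of_bool (Inl ` T \<subseteq> R)) (Inl ` T)" unfolding depends_on_def by auto
    show "depends_on (\<lambda>R. \<Prod>w\<in>e - {u} - T. ?q w R) (\<Union>w\<in>e - {u} - T. ?A w)"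
      by (intro depends_on_prod depends_on_mono[OF dep]) auto
    show "Inl ` T \<inter> (\<Union>w\<in>e - {u} - T. ?A w) = {}" using nbh_edge[OF e(1)] T by blast
  qed
  also have "ex (\<lambda>R. of_bool (Inl ` T \<subseteq> R)) = p ^ card T"
    using T e edge(1) by (intro ex_blocked) auto
  also have "ex (\<lambda>R. \<Prod>w\<in>e - {u} - T. ?q w R) = (\<Prod>w\<in>e - {u} - T. ex (?q w))"
    using fin_edge[OF e(1)] by (intro pexp_indep_prod[OF finG _ dep] disj) auto
  also have "\<dots> \<le> (\<Prod>w\<in>e - {u} - T. 1 / 2)"
  proof (intro prod_mono conjI)
    fix w assume w: "w \<in> e - {u} - T"
    then have wV: "w \<in> V" using e edge(1) by auto
    have "ex (?q w) = ex (\<lambda>R. 1 - of_bool (Inl w \<in> R)) * ex (surv (E - {e}) w)"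
    proof (rule pexp_indep[OF finG _ depends_surv])
      show "depends_on (\<lambda>R. 1 - of_bool (Inl w \<in> R)) {Inl w}" unfolding depends_on_def by auto
    qed auto
    also have "\<dots> = (1 - p) * ((1 / 2) / (1 - p ^ (card e - 1)))"
      using w e wV by (simp add: pexp_diff pexp_const finG ex_in ex_surv_del)
    finally have eq: "ex (?q w) = (1 - p) * ((1 / 2) / (1 - p ^ (card e - 1)))" .
    show "0 \<le> ex (?q w)" unfolding eq using pow_lt_1[OF e(1)] p by auto
    \<comment> \<open>Ignoring \<open>e\<close> raises the survival probability above 1/2 by the
      factor 1/(1 - p^(|e| - 1)); not being selected contributes 1 - p, which makes up for it as |e|
      >= 2.\<close>
    have "p ^ (card e - 1) \<le> p ^ 1" using p edge(2)[OF e(1)] by (intro power_decreasing) auto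
    then show "ex (?q w) \<le> 1 / 2" unfolding eq using pow_lt_1[OF e(1)] p by (simp add: field_simps)
  qed
  finally show ?thesis using p by (simp add: mult_left_mono)
qed

lemma ex_partial_le:
  assumes e: "e \<in> E" "u \<in> e" and l: "card e = Suc l" "i \<le> l"
  shows "ex (partial e u i) \<le> real (l choose i) * p ^ (l - i) * (1 / 2) ^ i"
proof -
  let ?TT = "{T. T \<subseteq> e - {u} \<and> card T = l - i}"
  let ?t = "\<lambda>T R. of_bool (Inl ` T \<subseteq> R) *
      (\<Prod>w\<in>e - {u} - T. (1 - of_bool (Inl w \<in> R)) * surv (E - {e}) w R)"
  have fin: "finite (e - {u})" using fin_edge e by auto
  have ce: "card (e - {u}) = l" using e l by simp
  have finT: "finite ?TT" using fin by simp
  have nn: "0 \<le> ?t T R" for T R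
    using surv_01 by (intro mult_nonneg_nonneg prod_nonneg) (auto, metis insertE order_refl singletonD zero_le_one)
  have "ex (partial e u i) \<le> ex (\<lambda>R. \<Sum>T\<in>?TT. ?t T R)"
  proof (rule pexp_mono[OF pr_bounds])
    fix R
    show "partial e u i R \<le> (\<Sum>T\<in>?TT. ?t T R)"
    proof (cases "partial e u i R = 0")
      case True
      then show ?thesis using nn by (simp add: sum_nonneg)
    next
      case False
      define T where "T = {w\<in>e - {u}. Inl w \<in> R}"
      from False have T: "card T = l - i" "\<forall>w\<in>e - {u}. Inl w \<notin> R \<longrightarrow> surv (E - {e}) w R = 1"
        unfolding partial_def T_def l by (auto split: if_splits)
      have "?t T R = 1" using T(2) unfolding T_def by (auto intro!: prod.neutral)
      moreover have "?t T R \<le> (\<Sum>T\<in>?TT. ?t T R)"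
        using T(1) by (intro member_le_sum nn finT) (auto simp: T_def)
      moreover have "partial e u i R \<le> 1" unfolding partial_def by auto
      ultimately show ?thesis by linarith
    qed
  qed auto
  also have "\<dots> = (\<Sum>T\<in>?TT. ex (?t T))" by (rule pexp_sum)
  also have "\<dots> \<le> (\<Sum>T\<in>?TT. p ^ (l - i) * (1 / 2) ^ i)"
  proof (rule sum_mono)
    fix T assume T: "T \<in> ?TT"
    then have "card (e - {u} - T) = i" using fin ce l finite_subset
      by (subst card_Diff_subset) auto
    then show "ex (?t T) \<le> p ^ (l - i) * (1 / 2) ^ i"
      using ex_partial_term[OF e, of T] T by auto
  qed
  also have "\<dots> = real (l choose i) * p ^ (l - i) * (1 / 2) ^ i"
    using n_subsets[OF fin, of "l - i"] ce l by (simp add: binomial_symmetric[symmetric])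
  finally show ?thesis .
qed

text \<open>The coefficient of x^i in the sum of all B_l (p + x/2)^l: a further vertex of an edge is
  selected with probability p or kept with probability at most 1/2. A round thus acts on the degree
  polynomial by the substitution p + x/2.\<close>

definition mean :: "nat \<Rightarrow> real" where
  "mean i = (\<Sum>l=i..K. B l * (real (l choose i) * p ^ (l - i) * (1 / 2) ^ i))"

text \<open>Counts the edges that would remain if no vertex were discarded for its degree, and
  ignores the fate of \<open>u\<close> itself. So \<open>rest\<close> can be defined from it without
  circularity; discarding only lowers degrees.\<close>

definition new_deg :: "'a \<Rightarrow> nat \<Rightarrow> ('a + 'a) set \<Rightarrow> real" where
  "new_deg u i R = (\<Sum>e\<in>{e\<in>E. u \<in> e \<and> i < card e}. partial e u i R)"

lemma new_deg_mean:
  assumes "u \<in> V" "1 \<le> i" "i \<le> K"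
  shows "(\<Sum>e\<in>{e\<in>E. u \<in> e \<and> i < card e}. ex (partial e u i)) \<le> mean i"
proof -
  let ?F = "{e\<in>E. u \<in> e \<and> i < card e}"
  have "(\<Sum>e\<in>?F. ex (partial e u i)) = (\<Sum>l\<in>{i..K}. \<Sum>e\<in>{e\<in>?F. card e - 1 = l}. ex (partial e u i))"
    using finE edge(3) by (intro sum.group[symmetric]) (auto simp: le_diff_conv)
  also have "\<dots> \<le> mean i" unfolding mean_def
  proof (rule sum_mono)
    fix l assume l: "l \<in> {i..K}"
    have eq: "{e\<in>?F. card e - 1 = l} = {e\<in>E. u \<in> e \<and> card e = Suc l}" using l by auto
    have "(\<Sum>e\<in>{e\<in>?F. card e - 1 = l}. ex (partial e u i)) \<le>
      (\<Sum>e\<in>{e\<in>?F. card e - 1 = l}. real (l choose i) * p ^ (l - i) * (1 / 2) ^ i)"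
      using l by (intro sum_mono ex_partial_le) auto
    also have "\<dots> = real (card {e\<in>E. u \<in> e \<and> card e = Suc l}) * (real (l choose i) * p ^ (l - i) * (1 / 2) ^ i)"
      unfolding eq by simp
    also have "\<dots> \<le> B l * (real (l choose i) * p ^ (l - i) * (1 / 2) ^ i)"
      using deg[OF assms(1), of l] l p assms by (intro mult_right_mono) auto
    finally show "(\<Sum>e\<in>{e\<in>?F. card e - 1 = l}. ex (partial e u i)) \<le>
      B l * (real (l choose i) * p ^ (l - i) * (1 / 2) ^ i)" .
  qed
  finally show ?thesis .
qed

lemma new_deg_tail:
  assumes "u \<in> V" "1 \<le> i" "i \<le> K" "mean i \<le> M" "M > 0" "\<delta> > 0"
  shows "ex (\<lambda>R. of_bool (new_deg u i R > (1 + \<delta>) * M)) \<le> 1 / (\<delta>\<^sup>2 * M)"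
  unfolding new_deg_def
proof (rule pexp_indicator_sum_tail[OF finG _ pr_bounds])
  show "finite {e\<in>E. u \<in> e \<and> i < card e}" using finE by auto
  show "partial e u i R \<in> {0, 1}" for e R unfolding partial_def by auto
  show "(\<Sum>e\<in>{e\<in>E. u \<in> e \<and> i < card e}. ex (partial e u i)) \<le> M"
    using new_deg_mean[OF assms(1-3)] assms(4) by linarith
  show "ex (\<lambda>R. partial e u i R * partial e' u i R) = ex (partial e u i) * ex (partial e' u i)"
    if "e \<in> {e\<in>E. u \<in> e \<and> i < card e}" "e' \<in> {e\<in>E. u \<in> e \<and> i < card e}" "e \<noteq> e'" for e e'
    using that by (intro partial_indep) auto
qed (use assms in auto)

text \<open>The outcome of the round: \<open>chosen\<close> joins the independent set, \<open>rest\<close> is the vertex set of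
  the next round.\<close>
definition chosen :: "('a + 'a) set \<Rightarrow> 'a set" where
  "chosen R = {w\<in>V. Inl w \<in> R \<and> surv E w R = 1}"

definition rest :: "(nat \<Rightarrow> real) \<Rightarrow> ('a + 'a) set \<Rightarrow> 'a set" where
  "rest B' R = {w\<in>V. Inl w \<notin> R \<and> surv E w R = 1 \<and> (\<forall>i\<in>{1..K}. new_deg w i R \<le> B' i)}"

text \<open>An edge with a vertex that is neither chosen nor kept can no longer be completed and is
  dropped.\<close>

definition next_edges :: "(nat \<Rightarrow> real) \<Rightarrow> ('a + 'a) set \<Rightarrow> 'a set set" where
  "next_edges B' R = {g. g \<noteq> {} \<and> g \<subseteq> rest B' R \<and> (\<exists>e\<in>E. g = e - chosen R)}"

lemma next_sparse: "sparse_hypergraph K B' (rest B' R) (next_edges B' R)"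
proof -
  have tr: "g \<in> next_edges B' R \<Longrightarrow> \<exists>e\<in>E. g = e - chosen R" for g unfolding next_edges_def by auto
  have size: "2 \<le> card g \<and> card g \<le> Suc K" if g: "g \<in> next_edges B' R" for g
  proof
    obtain e where e: "e \<in> E" "g = e - chosen R" "g \<noteq> {}" "g \<subseteq> rest B' R"
      using g unfolding next_edges_def by auto
    have fe: "finite e" using fin_edge e by auto
    have "card g \<le> card e" using e fe by (intro card_mono) auto
    then show "card g \<le> Suc K" using edge(3)[OF e(1)] by linarith
    \<comment> \<open>A single remaining vertex would have been blocked by \<open>e\<close>, all
      other vertices of \<open>e\<close> being selected.\<close>
    show "2 \<le> card g"
    proof (rule ccontr)
      assume "\<not> 2 \<le> card g"
      moreover have "card g \<noteq> 0" using e fe by auto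
      ultimately have "card g = 1" by linarith
      then obtain w where w: "g = {w}" using card_1_singletonE by blast
      then have "surv E w R = 1" "w \<in> e" using e unfolding rest_def by auto
      moreover have "Inl ` (e - {w}) \<subseteq> R" using e w unfolding chosen_def by auto
      ultimately show False using surv_blocked e(1) by blast
    qed
  qed
  have degs: "real (card {g\<in>next_edges B' R. u \<in> g \<and> card g = Suc i}) \<le> B' i"
    if u: "u \<in> rest B' R" and i: "i \<in> {1..K}" for u i
  proof -
    let ?A = "{g\<in>next_edges B' R. u \<in> g \<and> card g = Suc i}"
    let ?F = "{e\<in>E. u \<in> e \<and> i < card e}"
    let ?F1 = "{e\<in>?F. partial e u i R = 1}"
    have "?A \<subseteq> (\<lambda>e. e - chosen R) ` ?F1"
    proof
      fix g assume g: "g \<in> ?A"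
      then obtain e where e: "e \<in> E" "g = e - chosen R" "g \<subseteq> rest B' R"
        unfolding next_edges_def by auto
      have fe: "finite e" using fin_edge e by auto
      have uc: "u \<in> e" "u \<notin> chosen R" using g e by auto
      have cg: "card g \<le> card e" using e fe by (intro card_mono) auto
      \<comment> \<open>The vertices of \<open>g\<close> lie in \<open>rest\<close> and are
        unselected; those of \<open>e - g\<close> are chosen, hence selected.\<close>
      have eq: "{w\<in>e - {u}. Inl w \<in> R} = e - g"
        using e(2,3) uc g unfolding rest_def chosen_def by auto
      have "card (e - g) = card e - Suc i"
        using e(2) g fe by (subst card_Diff_subset) (auto intro: finite_subset)
      moreover have "surv (E - {e}) w R = 1" if "w \<in> e - {u}" "Inl w \<notin> R" for w
      proof -
        have "w \<in> rest B' R" using that e unfolding chosen_def by auto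
        then show ?thesis unfolding rest_def using finE by (auto intro: surv_antimono)
      qed
      ultimately have "partial e u i R = 1" unfolding partial_def eq by auto
      moreover have "i < card e" using cg g by auto
      ultimately show "g \<in> (\<lambda>e. e - chosen R) ` ?F1" using e uc by auto
    qed
    then have "card ?A \<le> card ((\<lambda>e. e - chosen R) ` ?F1)"
      using finE by (intro card_mono) auto
    also have "\<dots> \<le> card ?F1" using finE by (intro card_image_le) auto
    finally have "real (card ?A) \<le> real (card ?F1)" by simp
    also have "\<dots> = (\<Sum>e\<in>?F1. partial e u i R)" by simp
    also have "\<dots> \<le> new_deg u i R" unfolding new_deg_def
      using finE by (intro sum_mono2) (auto simp: partial_def)
    also have "\<dots> \<le> B' i" using u i unfolding rest_def by auto
    finally show ?thesis .
  qed
  have "finite (rest B' R)" using finV unfolding rest_def by auto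
  moreover have "uncrowded (next_edges B' R)" using uncrowded_trace[OF unc tr] by blast
  ultimately show ?thesis
    unfolding sparse_hypergraph_def using size degs by (auto simp: next_edges_def)
qed

text \<open>No edge lies inside \<open>chosen R\<close>, since it would have blocked its own
  vertices; any other edge inside the union leaves a nonempty trace inside \<open>J\<close>.\<close>

lemma indep_set_extend:
  assumes "J \<subseteq> rest B' R" "indep_set (next_edges B' R) J"
  shows "indep_set E (chosen R \<union> J)"
  unfolding indep_set_def
proof (intro ballI notI)
  fix e assume e: "e \<in> E" "e \<subseteq> chosen R \<union> J"
  show False
  proof (cases "e \<subseteq> chosen R")
    case True
    have "e \<noteq> {}" using edge(2)[OF e(1)] by auto
    then obtain w where "w \<in> e" by auto
    then show False using surv_blocked[of w R e] True e(1) unfolding chosen_def by auto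
  next
    case False
    then have "e - chosen R \<in> next_edges B' R" "e - chosen R \<subseteq> J"
      using e assms(1) unfolding next_edges_def by auto
    then show False using assms(2) unfolding indep_set_def by blast
  qed
qed

section \<open>Expected outcome of one round\<close>

lemma ex_chosen: "ex (\<lambda>R. real (card (chosen R))) = real (card V) * (p / 2)"
proof -
  have "ex (\<lambda>R. real (card (chosen R))) = ex (\<lambda>R. \<Sum>w\<in>V. of_bool (Inl w \<in> R) * surv E w R)"
  proof (rule pexp_cong)
    fix R
    have "real (card (chosen R)) = (\<Sum>w\<in>V. of_bool (w \<in> chosen R))"
      using finV unfolding chosen_def by (simp add: Collect_conj_eq)
    also have "\<dots> = (\<Sum>w\<in>V. of_bool (Inl w \<in> R) * surv E w R)"
      using surv_01[of E _ R] by (intro sum.cong) (auto simp: chosen_def)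
    finally show "real (card (chosen R)) = (\<Sum>w\<in>V. of_bool (Inl w \<in> R) * surv E w R)" .
  qed
  also have "\<dots> = (\<Sum>w\<in>V. ex (\<lambda>R. of_bool (Inl w \<in> R) * surv E w R))" by (rule pexp_sum)
  also have "\<dots> = (\<Sum>w\<in>V. p / 2)"
  proof (intro sum.cong refl)
    fix w assume "w \<in> V"
    moreover have "ex (\<lambda>R. of_bool (Inl w \<in> R) * surv E w R) = ex (\<lambda>R. of_bool (Inl w \<in> R)) * ex (surv E w)"
      by (rule pexp_indep[OF finG depends_on_mem depends_surv]) auto
    ultimately show "ex (\<lambda>R. of_bool (Inl w \<in> R) * surv E w R) = p / 2" by (simp add: ex_in ex_surv)
  qed
  finally show ?thesis by simp
qed

text \<open>Pointwise, the indicator of \<open>rest\<close> is at least that of surviving unselected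
  minus the number of violated degree bounds, and each violation has probability at most
  1/(\<delta>^2 m) by \<open>new_deg_tail\<close>. This avoids any joint treatment of survival and
  degrees.\<close>

lemma ex_rest:
  assumes "\<delta> > 0" "m > 0" and M: "\<And>i. i \<in> {1..K} \<Longrightarrow> mean i \<le> M i \<and> m \<le> M i"
  shows "ex (\<lambda>R. real (card (rest (\<lambda>i. (1 + \<delta>) * M i) R)))
    \<ge> real (card V) * ((1 - p) / 2 - real K / (\<delta>\<^sup>2 * m))"
proof -
  let ?b = "\<lambda>w i R. of_bool (new_deg w i R > (1 + \<delta>) * M i) :: real"
  let ?g = "\<lambda>w R. (surv E w R - of_bool (Inl w \<in> R) * surv E w R) - (\<Sum>i=1..K. ?b w i R)"
  have "real (card V) * ((1 - p) / 2 - real K / (\<delta>\<^sup>2 * m)) = (\<Sum>w\<in>V. (1 - p) / 2 - real K / (\<delta>\<^sup>2 * m))"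
    by simp
  also have "\<dots> \<le> (\<Sum>w\<in>V. ex (?g w))"
  proof (rule sum_mono)
    fix w assume w: "w \<in> V"
    have "ex (\<lambda>R. of_bool (Inl w \<in> R) * surv E w R) = ex (\<lambda>R. of_bool (Inl w \<in> R)) * ex (surv E w)"
      by (rule pexp_indep[OF finG depends_on_mem depends_surv]) auto
    then have "ex (?g w) = (1 - p) / 2 - (\<Sum>i=1..K. ex (?b w i))"
      using w by (simp add: pexp_diff pexp_sum ex_in ex_surv diff_divide_distrib del: sum_of_bool_eq)
    moreover have "(\<Sum>i=1..K. ex (?b w i)) \<le> (\<Sum>i=1..K. 1 / (\<delta>\<^sup>2 * m))"
    proof (rule sum_mono)
      fix i assume i: "i \<in> {1..K}"
      have "ex (?b w i) \<le> 1 / (\<delta>\<^sup>2 * M i)"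
        using i w M[OF i] assms(1,2) by (intro new_deg_tail) auto
      also have "\<dots> \<le> 1 / (\<delta>\<^sup>2 * m)"
        using M[OF i] assms(1,2) by (intro divide_left_mono mult_left_mono) auto
      finally show "ex (?b w i) \<le> 1 / (\<delta>\<^sup>2 * m)" .
    qed
    ultimately show "(1 - p) / 2 - real K / (\<delta>\<^sup>2 * m) \<le> ex (?g w)" by simp
  qed
  also have "\<dots> = ex (\<lambda>R. \<Sum>w\<in>V. ?g w R)" by (rule pexp_sum[symmetric])
  also have "\<dots> \<le> ex (\<lambda>R. real (card (rest (\<lambda>i. (1 + \<delta>) * M i) R)))"
  proof (rule pexp_mono[OF pr_bounds])
    fix R
    have "(\<Sum>w\<in>V. ?g w R) \<le> (\<Sum>w\<in>V. of_bool (w \<in> rest (\<lambda>i. (1 + \<delta>) * M i) R))"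
    proof (rule sum_mono)
      fix w assume w: "w \<in> V"
      have nn: "0 \<le> (\<Sum>i=1..K. ?b w i R)" by (intro sum_nonneg) auto
      have s: "surv E w R = 0 \<or> surv E w R = 1" using surv_01[of E w R] by auto
      show "?g w R \<le> of_bool (w \<in> rest (\<lambda>i. (1 + \<delta>) * M i) R)"
      proof (cases "\<exists>i\<in>{1..K}. new_deg w i R > (1 + \<delta>) * M i")
        case True
        then obtain i where i: "i \<in> {1..K}" "new_deg w i R > (1 + \<delta>) * M i" by auto
        have "?b w i R \<le> (\<Sum>i=1..K. ?b w i R)" using i by (intro member_le_sum) auto
        then have "1 \<le> (\<Sum>i=1..K. ?b w i R)" using i by simp
        then show ?thesis using s by auto
      next
        case False
        then have "\<forall>i\<in>{1..K}. new_deg w i R \<le> (1 + \<delta>) * M i" by (meson not_le)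
        then show ?thesis using s w nn by (auto simp: rest_def)
      qed
    qed
    also have "\<dots> = real (card (rest (\<lambda>i. (1 + \<delta>) * M i) R))"
      using finV unfolding rest_def by (simp add: Collect_conj_eq)
    finally show "(\<Sum>w\<in>V. ?g w R) \<le> real (card (rest (\<lambda>i. (1 + \<delta>) * M i) R))" .
  qed auto
  finally show ?thesis .
qed

text \<open>Since \<open>extend\<close> covers every hypergraph with the new bounds, the outcome
  \<open>R\<close> can be fixed first, from the expectation alone, and \<open>J\<close> is found
  inside it afterwards.\<close>

theorem nibble_step:
  assumes "\<delta> > 0" "m > 0" and M: "\<And>i. i \<in> {1..K} \<Longrightarrow> mean i \<le> M i \<and> m \<le> M i"
    and "\<beta> \<ge> 0"
    and extend: "\<And>V' E'. sparse_hypergraph K (\<lambda>i. (1 + \<delta>) * M i) V' E' \<Longrightarrow>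
      \<exists>J\<subseteq>V'. indep_set E' J \<and> real (card J) \<ge> real (card (V' :: 'a set)) * \<beta>"
  shows "\<exists>J\<subseteq>V. indep_set E J \<and>
    real (card J) \<ge> real (card V) * (p / 2 + \<beta> * ((1 - p) / 2 - real K / (\<delta>\<^sup>2 * m)))"
proof -
  let ?B' = "\<lambda>i. (1 + \<delta>) * M i"
  have "ex (\<lambda>R. real (card (chosen R)) + \<beta> * real (card (rest ?B' R))) =
    ex (\<lambda>R. real (card (chosen R))) + \<beta> * ex (\<lambda>R. real (card (rest ?B' R)))"
    by (simp add: pexp_add pexp_cmult)
  also have "\<dots> \<ge> real (card V) * (p / 2) + \<beta> * (real (card V) * ((1 - p) / 2 - real K / (\<delta>\<^sup>2 * m)))"
    using ex_rest[OF assms(1,2) M] ex_chosen assms(4) by (intro add_mono mult_left_mono) auto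
  finally obtain R where R: "real (card (chosen R)) + \<beta> * real (card (rest ?B' R)) \<ge>
      real (card V) * (p / 2) + \<beta> * (real (card V) * ((1 - p) / 2 - real K / (\<delta>\<^sup>2 * m)))"
    using pexp_exists[OF finG pr_bounds] by meson
  obtain J where J: "J \<subseteq> rest ?B' R" "indep_set (next_edges ?B' R) J"
    "real (card J) \<ge> real (card (rest ?B' R)) * \<beta>"
    using extend[OF next_sparse] by blast
  have fin: "finite (chosen R)" "finite J"
    using finV J(1) unfolding chosen_def rest_def by (auto intro: finite_subset)
  have "chosen R \<inter> J = {}" using J(1) unfolding chosen_def rest_def by auto
  then have "real (card (chosen R \<union> J)) = real (card (chosen R)) + real (card J)"
    using fin by (simp add: card_Un_disjoint)
  then have "real (card (chosen R \<union> J)) \<ge>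
      real (card V) * (p / 2 + \<beta> * ((1 - p) / 2 - real K / (\<delta>\<^sup>2 * m)))"
    using R J(3) by (simp add: algebra_simps)
  moreover have "chosen R \<union> J \<subseteq> V" using J(1) unfolding chosen_def rest_def by auto
  ultimately show ?thesis using indep_set_extend[OF J(1,2)] by blast
qed

end

text \<open>After \<open>s\<close> rounds the independent set has density \<open>t s\<close>, a vertex has survived with
  probability \<open>2\<^sup>-\<^sup>s\<close>, and the degrees are, up to the factor \<open>(1 + 1/S)\<^sup>s\<close>, the coefficients of
  \<open>d\<^sup>K ((t s + 2\<^sup>-\<^sup>s x)\<^sup>K - (t s)\<^sup>K)\<close>.  The values \<open>t s\<close> are chosen such that \<open>d\<^sup>K (t s)\<^sup>K\<close> grows by
  \<open>1/8\<close> per round.\<close>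
locale nibble_schedule =
  fixes K S :: nat and d :: real
  assumes K: "1 \<le> K" and S: "1 \<le> S" and d: "1 \<le> d" and dS: "2 ^ S \<le> sqrt d"
    and room: "real S / sqrt d + 2 * real K * (real S)\<^sup>2 * 8 ^ K / sqrt d \<le> 1 / (2 * real S)"
begin

section \<open>Parameters of the successive rounds\<close>

definition t :: "nat \<Rightarrow> real" where "t s = root K (real s / 8) / d"

definition bound :: "nat \<Rightarrow> nat \<Rightarrow> real" where
  "bound s i = (1 + 1 / real S) ^ s * (d ^ K * real (K choose i) * t s ^ (K - i) * (1 / 2) ^ (s * i))"

text \<open>A vertex reaches round s with probability about 2^-s, so this selection probability
  raises the density of selected vertices from \<open>t s\<close> to
  \<open>t (Suc s)\<close>.\<close>

definition prob :: "nat \<Rightarrow> real" where "prob s = (t (Suc s) - t s) * 2 ^ s"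

text \<open>The density that rounds s to S - 1 still guarantee: the remaining increase of
  \<open>t\<close>, relative to the 2^-s vertices left, halved because a selected vertex survives
  with probability 1/2, and damped by 1 - 1/(2S) per round to account for selected and discarded
  vertices.\<close>

definition gain :: "nat \<Rightarrow> real" where
  "gain s = (1 / 2) * 2 ^ s * (1 - 1 / (2 * real S)) ^ (S - s) * (t S - t s)"

lemma t_nonneg: "0 \<le> t s" unfolding t_def using d by (intro divide_nonneg_nonneg real_root_ge_zero) auto

lemma t_mono: "s \<le> s' \<Longrightarrow> t s \<le> t s'"
  unfolding t_def using d K by (intro divide_right_mono) auto

lemma d_t: "d ^ K * t s ^ K = real s / 8"
  unfolding t_def using d K by (simp add: power_divide)

lemma factor_le: "s \<le> S \<Longrightarrow> (1 + 1 / real S) ^ s \<le> 3"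
proof -
  assume s: "s \<le> S"
  have "(1 + 1 / real S) ^ s \<le> (1 + 1 / real S) ^ S" using s by (intro power_increasing) auto
  also have "\<dots> \<le> exp (1 / real S) ^ S"
    by (intro power_mono) (auto simp: exp_ge_add_one_self)
  also have "\<dots> = exp 1" using S by (simp add: exp_of_nat_mult[symmetric])
  also have "\<dots> \<le> 3" by (rule exp_le)
  finally show ?thesis .
qed

lemma prob_nonneg: "0 \<le> prob s"
  unfolding prob_def using t_mono[of s "Suc s"] by simp

lemma prob_le:
  assumes "s < S"
  shows "prob s \<le> real S / sqrt d"
proof -
  have "root K (real S / 8) \<le> root K (real S ^ K)"
  proof (rule real_root_le_mono)
    have "real S / 8 \<le> real S ^ 1" by simp
    also have "\<dots> \<le> real S ^ K" using S K by (intro power_increasing) auto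
    finally show "real S / 8 \<le> real S ^ K" .
  qed (use K in auto)
  also have "\<dots> = real S" using K by (intro real_root_power_cancel) auto
  finally have "t S \<le> real S / d" unfolding t_def using d by (intro divide_right_mono) auto
  then have "t (Suc s) - t s \<le> real S / d" using t_mono[of "Suc s" S] t_nonneg[of s] assms by linarith
  moreover have "2 ^ s \<le> sqrt d"
  proof -
    have "2 ^ s \<le> (2::real) ^ S" using assms by (intro power_increasing) auto
    then show ?thesis using dS by linarith
  qed
  ultimately have "prob s \<le> real S / d * sqrt d"
    unfolding prob_def using d by (intro mult_mono) auto
  also have "\<dots> = real S / sqrt d"
    using d by (simp add: field_simps)
  finally show ?thesis .
qed

lemma prob_less_1: "s < S \<Longrightarrow> prob s < 1"
proof -
  assume "s < S"
  then have "prob s \<le> 1 / (2 * real S)" using prob_le[of s] room d by (smt (verit) divide_nonneg_nonneg mult_nonneg_nonneg of_nat_0_le_iff real_sqrt_ge_zero zero_le_power zero_le_power2)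
  also have "\<dots> < 1" using S by simp
  finally show ?thesis .
qed

lemma bound_step:
  assumes "l \<ge> i"
  shows "bound s l * prob s ^ (l - i) * (1 / 2) ^ i =
    (1 + 1 / real S) ^ s * d ^ K * (1 / 2) ^ (Suc s * i) *
    (real (K choose l) * t s ^ (K - l) * (t (Suc s) - t s) ^ (l - i))"
proof -
  have "(1 / 2 :: real) ^ (s * l) * (2 ^ s) ^ (l - i) = (1 / 2) ^ (s * i)"
  proof -
    have "s * l = s * i + s * (l - i)" using assms by (simp add: add_mult_distrib2[symmetric])
    then have "(1 / 2 :: real) ^ (s * l) = (1 / 2) ^ (s * i) * (1 / 2) ^ (s * (l - i))"
      by (simp add: power_add)
    moreover have "(1 / 2 :: real) ^ (s * (l - i)) * (2 ^ s) ^ (l - i) = 1"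
      by (simp add: power_mult[symmetric] power_mult_distrib[symmetric])
    ultimately show ?thesis by simp
  qed
  then have "(1 / 2 :: real) ^ (s * l) * (2 ^ s) ^ (l - i) * (1 / 2) ^ i = (1 / 2) ^ (Suc s * i)"
    by (simp add: power_add)
  note this[symmetric]
  moreover have "bound s l * prob s ^ (l - i) * (1 / 2) ^ i =
    (1 + 1 / real S) ^ s * d ^ K * ((1 / 2) ^ (s * l) * (2 ^ s) ^ (l - i) * (1 / 2) ^ i) *
    (real (K choose l) * t s ^ (K - l) * (t (Suc s) - t s) ^ (l - i))"
    unfolding bound_def prob_def power_mult_distrib by (simp only: mult_ac)
  ultimately show ?thesis by (simp only:)
qed

text \<open>The substitution p + x/2 of \<open>mean\<close> turns (t(s) + 2^-s x)^K into (t(s+1) +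
  2^-(s+1) x)^K, because t(s) + 2^-s p = t(s+1). The proof compares coefficients of x^i.\<close>

lemma mean_eq:
  assumes "i \<le> K"
  shows "(\<Sum>l=i..K. bound s l * (real (l choose i) * prob s ^ (l - i) * (1 / 2) ^ i)) =
    (1 + 1 / real S) ^ s * (d ^ K * real (K choose i) * t (Suc s) ^ (K - i) * (1 / 2) ^ (Suc s * i))"
proof -
  let ?D = "t (Suc s) - t s" and ?A = "(1 + 1 / real S) ^ s * d ^ K * (1 / 2) ^ (Suc s * i)"
  have "(\<Sum>l=i..K. bound s l * (real (l choose i) * prob s ^ (l - i) * (1 / 2) ^ i)) =
    (\<Sum>l=i..K. ?A * real (K choose i) * (real ((K - i) choose (l - i)) * ?D ^ (l - i) * t s ^ (K - l)))"
  proof (intro sum.cong refl)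
    fix l assume l: "l \<in> {i..K}"
    have "bound s l * (real (l choose i) * prob s ^ (l - i) * (1 / 2) ^ i) =
      real (l choose i) * (bound s l * prob s ^ (l - i) * (1 / 2) ^ i)" by simp
    also have "\<dots> = ?A * (real (K choose l) * real (l choose i)) * (?D ^ (l - i) * t s ^ (K - l))"
      using l by (subst bound_step) (auto simp: mult_ac)
    also have "real (K choose l) * real (l choose i) = real (K choose i) * real ((K - i) choose (l - i))"
      using l by (simp add: choose_mult flip: of_nat_mult)
    finally show "bound s l * (real (l choose i) * prob s ^ (l - i) * (1 / 2) ^ i) =
      ?A * real (K choose i) * (real ((K - i) choose (l - i)) * ?D ^ (l - i) * t s ^ (K - l))"
      by (simp add: mult_ac)
  qed
  also have "\<dots> = ?A * real (K choose i) *
      (\<Sum>l=i..K. real ((K - i) choose (l - i)) * ?D ^ (l - i) * t s ^ (K - l))"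
    by (simp add: sum_distrib_left)
  also have "(\<Sum>l=i..K. real ((K - i) choose (l - i)) * ?D ^ (l - i) * t s ^ (K - l)) =
    (\<Sum>k\<le>K - i. real ((K - i) choose k) * ?D ^ k * t s ^ (K - i - k))"
    using assms by (intro sum.reindex_bij_witness[of _ "\<lambda>k. k + i" "\<lambda>l. l - i"]) auto
  also have "\<dots> = (?D + t s) ^ (K - i)" by (rule binomial_ring[symmetric])
  finally show ?thesis by (simp add: mult_ac)
qed

text \<open>The case i = 0 of \<open>mean_eq\<close>, with the constant term subtracted, leaves the
  increase 1/8 of d^K t(s)^K times the accumulated factor. That factor is at most 3, and 3/8 is
  below 1/2.\<close>

lemma kill_le:
  assumes "s < S"
  shows "(\<Sum>j=1..K. bound s j * prob s ^ j) \<le> 1 / 2"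
proof -
  have "(\<Sum>l=0..K. bound s l * (real (l choose 0) * prob s ^ (l - 0) * (1 / 2) ^ 0)) =
    (1 + 1 / real S) ^ s * (d ^ K * t (Suc s) ^ K)"
    by (subst mean_eq) auto
  moreover have "(\<Sum>l=0..K. bound s l * (real (l choose 0) * prob s ^ (l - 0) * (1 / 2) ^ 0)) =
    bound s 0 + (\<Sum>j=1..K. bound s j * prob s ^ j)"
    by (subst sum.atLeast_Suc_atMost) auto
  moreover have "bound s 0 = (1 + 1 / real S) ^ s * (d ^ K * t s ^ K)" unfolding bound_def by simp
  ultimately have "(\<Sum>j=1..K. bound s j * prob s ^ j) = (1 + 1 / real S) ^ s / 8"
    unfolding d_t by (simp add: field_simps)
  then show ?thesis using factor_le[of s] assms by simp
qed

text \<open>Chebyshev's inequality needs large means. Here t(s+1) >= 1/(8d) and d 2^-(s+1) >= sqrt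
  d, so the bound is at least of order (sqrt d)^i with i >= 1. The estimate concerns the degree
  bounds; the degrees themselves may be smaller.\<close>

lemma mean_ge:
  assumes "s < S" "1 \<le> i" "i \<le> K"
  shows "(1 + 1 / real S) ^ s * (d ^ K * real (K choose i) * t (Suc s) ^ (K - i) * (1 / 2) ^ (Suc s * i))
    \<ge> sqrt d / 8 ^ K"
proof -
  have r: "1 / 8 \<le> root K (real (Suc s) / 8)"
  proof -
    have "(1 / 8 :: real) = root K ((1 / 8) ^ K)" using K by (simp add: real_root_power_cancel)
    also have "\<dots> \<le> root K (real (Suc s) / 8)"
    proof (rule real_root_le_mono)
      have "(1 / 8 :: real) ^ K \<le> (1 / 8) ^ 1" using K by (intro power_decreasing) auto
      then show "(1 / 8 :: real) ^ K \<le> real (Suc s) / 8" by simp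
    qed (use K in auto)
    finally show ?thesis .
  qed
  have dpos: "d > 0" using d by simp
  have "(1 / 8 / d) ^ (K - i) \<le> t (Suc s) ^ (K - i)"
    unfolding t_def using r d by (intro power_mono divide_right_mono) auto
  have "sqrt d ^ 1 \<le> sqrt d ^ i" using assms d by (intro power_increasing) auto
  also have "\<dots> \<le> (d * (1 / 2) ^ Suc s) ^ i"
  proof (rule power_mono)
    have "(2::real) ^ Suc s \<le> 2 ^ S" using assms by (intro power_increasing) auto
    then have "sqrt d * 2 ^ Suc s \<le> sqrt d * sqrt d" using dS d by (intro mult_left_mono) auto
    then show "sqrt d \<le> d * (1 / 2) ^ Suc s" using d by (simp add: field_simps)
  qed (use d in auto)
  finally have "sqrt d / 8 ^ K \<le> (d * (1 / 2) ^ Suc s) ^ i / 8 ^ K"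
    by (simp add: divide_right_mono)
  also have "\<dots> \<le> (d * (1 / 2) ^ Suc s) ^ i / 8 ^ (K - i)"
    using d by (intro divide_left_mono power_increasing) auto
  also have "\<dots> = d ^ K * (1 / 8 / d) ^ (K - i) * (1 / 2) ^ (Suc s * i)"
  proof -
    have "d ^ K = d ^ i * d ^ (K - i)" using assms by (simp flip: power_add)
    then show ?thesis using dpos unfolding power_mult power_mult_distrib power_divide by simp
  qed
  also have "\<dots> \<le> d ^ K * t (Suc s) ^ (K - i) * (1 / 2) ^ (Suc s * i)"
    using \<open>(1 / 8 / d) ^ (K - i) \<le> _\<close> d by (intro mult_right_mono mult_left_mono) auto
  also have "\<dots> \<le> real (K choose i) * (d ^ K * t (Suc s) ^ (K - i) * (1 / 2) ^ (Suc s * i))"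
  proof -
    have "1 \<le> K choose i" using zero_less_binomial[OF assms(3)] by linarith
    then have "1 * (d ^ K * t (Suc s) ^ (K - i) * (1 / 2) ^ (Suc s * i)) \<le>
        real (K choose i) * (d ^ K * t (Suc s) ^ (K - i) * (1 / 2) ^ (Suc s * i))"
      using d t_nonneg[of "Suc s"] by (intro mult_right_mono) auto
    then show ?thesis by simp
  qed
  also have "\<dots> \<le> (1 + 1 / real S) ^ s * (real (K choose i) * (d ^ K * t (Suc s) ^ (K - i) * (1 / 2) ^ (Suc s * i)))"
  proof -
    let ?X = "real (K choose i) * (d ^ K * t (Suc s) ^ (K - i) * (1 / 2) ^ (Suc s * i))"
    have "1 * ?X \<le> (1 + 1 / real S) ^ s * ?X"
      using d t_nonneg[of "Suc s"] by (intro mult_right_mono one_le_power) auto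
    then show ?thesis by simp
  qed
  finally show ?thesis by (simp add: mult_ac)
qed

lemma gain_nonneg: "s \<le> S \<Longrightarrow> 0 \<le> gain s"
  unfolding gain_def using t_mono[of s S] S by (auto intro!: mult_nonneg_nonneg)

text \<open>Split the remaining increase of \<open>t\<close> at t(s+1): the present round pays for
  the first part by \<open>prob s / 2\<close>, the later rounds for the second. By
  \<open>room\<close>, the selection probability plus twice the discard probability, for \<delta> =
  1/S and m = sqrt d / 8^K, is at most 1/(2S).\<close>

lemma gain_step:
  assumes "s < S"
  shows "gain s \<le> prob s / 2 + gain (Suc s) * ((1 - prob s) / 2 - real K / ((1 / real S)\<^sup>2 * (sqrt d / 8 ^ K)))"
proof -
  let ?x = "1 - 1 / (2 * real S)"
  have x: "0 \<le> ?x" "?x \<le> 1" using S by (auto simp: field_simps)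
  have "2 * (real K / ((1 / real S)\<^sup>2 * (sqrt d / 8 ^ K))) = 2 * real K * (real S)\<^sup>2 * 8 ^ K / sqrt d"
    using S by (simp add: field_simps)
  note room' = room[folded this]
  have "z + 2 * y \<le> w \<Longrightarrow> q \<le> z \<Longrightarrow> (1 - w) / 2 \<le> (1 - q) / 2 - y" for w q y z :: real
    by (simp add: field_simps)
  note this[OF room' prob_le[OF assms]]
  then have "gain (Suc s) * (?x / 2) \<le> gain (Suc s) * ((1 - prob s) / 2 - real K / ((1 / real S)\<^sup>2 * (sqrt d / 8 ^ K)))"
    using gain_nonneg[of "Suc s"] assms by (intro mult_left_mono) auto
  moreover have "gain (Suc s) * (?x / 2) = (1 / 2) * 2 ^ s * ?x ^ (S - s) * (t S - t (Suc s))"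
  proof -
    have "S - s = Suc (S - Suc s)" using assms by simp
    then show ?thesis unfolding gain_def by simp
  qed
  moreover have "(1 / 2) * 2 ^ s * ?x ^ (S - s) * (t (Suc s) - t s) \<le> prob s / 2"
  proof -
    have "?x ^ (S - s) * (t (Suc s) - t s) \<le> 1 * (t (Suc s) - t s)"
      using x t_mono[of s "Suc s"] by (intro mult_right_mono power_le_one) auto
    then show ?thesis unfolding prob_def by simp
  qed
  moreover have "gain s = (1 / 2) * 2 ^ s * ?x ^ (S - s) * (t S - t (Suc s)) + (1 / 2) * 2 ^ s * ?x ^ (S - s) * (t (Suc s) - t s)"
    unfolding gain_def distrib_left[symmetric] by simp
  ultimately show ?thesis by linarith
qed

text \<open>Backward induction, because \<open>gain (Suc s)\<close> is the weight \<beta> of the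
  remaining vertices in round s. At s = S the gain is 0 and the empty set suffices.\<close>

lemma large_indep_set_round:
  fixes V :: "'a set"
  assumes "s \<le> S" "sparse_hypergraph K (bound s) V E"
  shows "\<exists>J\<subseteq>V. indep_set E J \<and> real (card J) \<ge> real (card V) * gain s"
  using assms
proof (induction s arbitrary: V E rule: inc_induct)
  case base
  have "\<not> e \<subseteq> {}" if "e \<in> E" for e
    using base that unfolding sparse_hypergraph_def by fastforce
  then show ?case by (intro exI[of _ "{}"]) (auto simp: indep_set_def gain_def)
next
  case (step s)
  interpret nibble K "bound s" V E "prob s"
    using step prob_nonneg prob_less_1 kill_le by unfold_locales auto
  let ?M = "\<lambda>i. (1 + 1 / real S) ^ s * (d ^ K * real (K choose i) * t (Suc s) ^ (K - i) * (1 / 2) ^ (Suc s * i))"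
  have M: "mean i \<le> ?M i \<and> sqrt d / 8 ^ K \<le> ?M i" if "i \<in> {1..K}" for i
    using that mean_eq[of i s] mean_ge[of s i] step unfolding mean_def by auto
  \<comment> \<open>The Chebyshev tolerance 1/S is exactly the growth per round of the factor (1 +
    1/S)^s in \<open>bound\<close>.\<close>
  have B: "(\<lambda>i. (1 + 1 / real S) * ?M i) = bound (Suc s)"
    unfolding bound_def by (simp add: mult_ac)
  obtain J where J: "J \<subseteq> V" "indep_set E J" "real (card J) \<ge> real (card V) *
      (prob s / 2 + gain (Suc s) * ((1 - prob s) / 2 - real K / ((1 / real S)\<^sup>2 * (sqrt d / 8 ^ K))))"
    using nibble_step[of "1 / real S" "sqrt d / 8 ^ K" ?M "gain (Suc s)", unfolded B, OF _ _ M]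
      S d gain_nonneg[of "Suc s"] step by auto
  have "real (card V) * gain s \<le> real (card J)"
    using gain_step[of s] step by (intro order.trans[OF _ J(3)] mult_left_mono) auto
  then show ?case using J by blast
qed

lemma large_indep_set:
  fixes V :: "'a set"
  assumes "sparse_hypergraph K (\<lambda>j. if j = K then d ^ K else 0) V E"
  shows "\<exists>J\<subseteq>V. indep_set E J \<and> real (card J) \<ge> real (card V) * (root K (real S / 8) / (4 * d))"
proof -
  have "sparse_hypergraph K (bound 0) V E"
  proof -
    \<comment> \<open>As t(0) = 0 and 0^0 = 1, only j = K has a nonzero bound.\<close>
    have "bound 0 j = (if j = K then d ^ K else 0)" if "j \<in> {1..K}" for j
      using that unfolding bound_def t_def by (auto simp: power_0_left)
    then show ?thesis using assms unfolding sparse_hypergraph_def by simp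
  qed
  then obtain J where J: "J \<subseteq> V" "indep_set E J" "real (card J) \<ge> real (card V) * gain 0"
    using large_indep_set_round by blast
  \<comment> \<open>By Bernoulli's inequality the damping over all S rounds loses at most a factor
    2.\<close>
  have "1 + real S * (- 1 / (2 * real S)) \<le> (1 + (- 1 / (2 * real S))) ^ S"
    using S by (intro Bernoulli_inequality) (simp add: field_simps)
  then have "1 / 2 \<le> (1 - 1 / (2 * real S)) ^ S" using S by simp
  then have "1 / 2 * t S \<le> (1 - 1 / (2 * real S)) ^ S * t S" by (intro mult_right_mono t_nonneg)
  moreover have "t 0 = 0" unfolding t_def by simp
  ultimately have "t S / 4 \<le> gain 0" unfolding gain_def by simp
  then have "root K (real S / 8) / (4 * d) \<le> gain 0" unfolding t_def by (simp add: mult.commute)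
  then have "real (card V) * (root K (real S / 8) / (4 * d)) \<le> real (card J)"
    by (intro order.trans[OF _ J(3)] mult_left_mono) auto
  then show ?thesis using J by blast
qed

end

text \<open>The number S of rounds is about (log_2 d)/2, the most that 2^S <= sqrt d permits, and it
  becomes the logarithm through root K (S/8). The condition \<open>room\<close> asks only that sqrt
  d dominate S^3.\<close>

theorem uncrowded_indep_set:
  assumes K: "1 \<le> K"
  shows "\<exists>c>0. \<exists>d0. \<forall>d\<ge>d0. \<forall>V :: 'a set. \<forall>E.
    sparse_hypergraph K (\<lambda>j. if j = K then d ^ K else 0) V E \<longrightarrow>
    (\<exists>J\<subseteq>V. indep_set E J \<and> real (card J) \<ge> c * real (card V) * (root K (ln d) / d))"
proof -
  \<comment> \<open>Multiplied by 2 S sqrt d, \<open>room\<close> reads 2 S^2 + 4 K 8^K S^3 <= sqrt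
    d; this \<open>C\<close> reduces it to C (log_2 d)^3 <= sqrt d.\<close>
  define C where "C = 1 + 4 * real K * 8 ^ K"
  have "((\<lambda>d::real. (log 2 d) ^ 3 / sqrt d) \<longlongrightarrow> 0) at_top" by real_asymp
  then have "\<forall>\<^sub>F d::real in at_top. (log 2 d) ^ 3 / sqrt d < 1 / C"
    by (rule order_tendstoD) (simp add: C_def add_pos_nonneg)
  moreover have "\<forall>\<^sub>F d::real in at_top. 16 \<le> d" by (rule eventually_ge_at_top)
  ultimately have "\<forall>\<^sub>F d::real in at_top. 16 \<le> d \<and> (log 2 d) ^ 3 / sqrt d < 1 / C"
    by (rule eventually_conj[rotated])
  then obtain d0 where d0: "\<And>d. d \<ge> d0 \<Longrightarrow> 16 \<le> d \<and> (log 2 d) ^ 3 / sqrt d < 1 / C"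
    unfolding eventually_at_top_linorder by blast
  have main: "\<exists>J\<subseteq>V. indep_set E J \<and> real (card J) \<ge> root K (1 / 32) / 4 * real (card V) * (root K (ln d) / d)"
    if d: "d \<ge> d0" and sp: "sparse_hypergraph K (\<lambda>j. if j = K then d ^ K else 0) V E"
    for d and V :: "'a set" and E
  proof -
    define S where "S = nat \<lfloor>log 2 d / 2\<rfloor>"
    have d16: "16 \<le> d" using d0[OF d] by simp
    have "log 2 16 \<le> log 2 d" using d16 by (subst log_le_cancel_iff) auto
    moreover have "log 2 (16::real) = 4" using log_pow_cancel[of "2::real" 4] by simp
    ultimately have l4: "4 \<le> log 2 d" by simp
    have S1: "real S \<le> log 2 d / 2" "log 2 d / 2 - 1 < real S" unfolding S_def using l4 by linarith+
    have S: "1 \<le> S" using S1 l4 by linarith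
    have "2 ^ S = 2 powr real S" by (simp add: powr_realpow)
    also have "\<dots> \<le> 2 powr (log 2 d / 2)" using S1 by simp
    also have "\<dots> = (2 powr (log 2 d)) powr (1 / 2)" by (simp add: powr_powr)
    also have "\<dots> = sqrt d" using d16 by (simp add: powr_half_sqrt)
    finally have dS: "2 ^ S \<le> sqrt d" .
    have sq: "0 < sqrt d" using d16 by simp
    have "2 * (real S)\<^sup>2 * 1 \<le> 2 * (real S)\<^sup>2 * real S" using S by (intro mult_left_mono) auto
    then have "2 * (real S)\<^sup>2 \<le> 2 * real S ^ 3" by (simp add: power2_eq_square power3_eq_cube)
    moreover have "0 \<le> real K * 8 ^ K * real S ^ 3" by simp
    moreover have "2 * C * real S ^ 3 = 2 * real S ^ 3 + 8 * (real K * 8 ^ K * real S ^ 3)"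
      unfolding C_def by (simp add: algebra_simps)
    ultimately have "2 * (real S)\<^sup>2 + 4 * real K * 8 ^ K * real S ^ 3 \<le> 2 * C * real S ^ 3"
      by linarith
    also have "\<dots> \<le> 2 * C * (log 2 d / 2) ^ 3"
      using S1 unfolding C_def by (intro mult_left_mono power_mono) auto
    also have "\<dots> \<le> C * (log 2 d) ^ 3"
      using l4 unfolding C_def by (simp add: power_divide)
    also have "\<dots> \<le> sqrt d"
    proof -
      have "C > 0" unfolding C_def by (simp add: add_pos_nonneg)
      moreover have "log 2 d ^ 3 < 1 / C * sqrt d"
        using d0[OF d] by (simp only: pos_divide_less_eq[OF sq])
      ultimately show ?thesis by (simp add: field_simps)
    qed
    finally have "2 * (real S)\<^sup>2 + 4 * real K * 8 ^ K * real S ^ 3 \<le> sqrt d" .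
    then have room: "real S / sqrt d + 2 * real K * (real S)\<^sup>2 * 8 ^ K / sqrt d \<le> 1 / (2 * real S)"
      using S sq by (simp add: field_simps power2_eq_square power3_eq_cube)
    interpret nibble_schedule K S d
      using K S d16 dS room by unfold_locales auto
    obtain J where J: "J \<subseteq> V" "indep_set E J"
      "real (card J) \<ge> real (card V) * (root K (real S / 8) / (4 * d))"
      using large_indep_set[OF sp] by blast
    \<comment> \<open>For d >= 16 the value (log_2 d)/2 - 1 is at least (log_2 d)/4; together with
      the 8 in \<open>t\<close> this gives the constant 1/32.\<close>
    have "ln d / 4 \<le> real S"
    proof -
      have "ln d \<le> log 2 d"
        using d16 ln_le_minus_one[of "2 :: real"] mult_left_le[of "ln 2" "ln d"]
        unfolding log_def by (simp add: pos_le_divide_eq)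
      then show ?thesis using S1 l4 by linarith
    qed
    then have "root K (1 / 32 * ln d) \<le> root K (real S / 8)" using K by (intro real_root_le_mono) auto
    then have "root K (1 / 32) * root K (ln d) \<le> root K (real S / 8)" by (simp only: real_root_mult)
    then have "root K (1 / 32) * root K (ln d) / (4 * d) \<le> root K (real S / 8) / (4 * d)"
      using d16 by (intro divide_right_mono) auto
    then have "real (card V) * (root K (1 / 32) * root K (ln d) / (4 * d)) \<le> real (card J)"
      by (intro order.trans[OF _ J(3)] mult_left_mono) auto
    then show ?thesis using J by (intro exI[of _ J]) (simp add: mult_ac)
  qed
  have "root K (1 / 32) / 4 > 0" using K by simp
  then show ?thesis using main by blast
qed

section \<open>Excess of a family of sets\<close>

text \<open>With \<open>\<alpha> = (er - v)/(e - 1)\<close>, the excess is \<open>e - 1\<close> times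
  \<open>\<bar>\<Union>F\<bar> - r \<bar>F\<bar> + (\<bar>F\<bar> - 1) \<alpha>\<close>.  The forbidden configurations of \<open>i < e\<close> edges are those of
  negative excess, those of \<open>e\<close> edges are those of nonpositive excess.\<close>
locale exponent =
  fixes r e v :: nat and P :: int
  assumes r: "3 \<le> r" and e: "3 \<le> e" and v: "r + 1 \<le> v"
    and P_def: "P = int e * int r - int v" and P_pos: "0 < P"
    and coprime: "gcd (int e - 1) P = 1"
begin

definition excess :: "'a set set \<Rightarrow> int" where
  "excess F = (int e - 1) * (int (card (\<Union>F)) - int (card F) * int r) + (int (card F) - 1) * P"

text \<open>The size of the union is submodular, the terms linear in |F| are modular, and the
  constant -P occurs twice on each side. The empty family has excess -P < 0, so applications must
  ensure that the two families meet.\<close>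

lemma excess_submodular:
  assumes "finite F" "finite H" "\<And>A. A \<in> F \<union> H \<Longrightarrow> finite A"
  shows "excess (F \<union> H) + excess (F \<inter> H) \<le> excess F + excess H"
proof -
  have fin: "finite (\<Union>F)" "finite (\<Union>H)" using assms by auto
  have "card (\<Union>(F \<union> H)) + card (\<Union>(F \<inter> H)) \<le> card (\<Union>F \<union> \<Union>H) + card (\<Union>F \<inter> \<Union>H)"
    using fin by (intro add_mono card_mono) auto
  also have "\<dots> = card (\<Union>F) + card (\<Union>H)" using card_Un_Int[OF fin] by simp
  finally have "int (card (\<Union>(F \<union> H))) + int (card (\<Union>(F \<inter> H))) \<le> int (card (\<Union>F)) + int (card (\<Union>H))"
    by linarith
  then have 1: "(int e - 1) * (int (card (\<Union>(F \<union> H))) + int (card (\<Union>(F \<inter> H))))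
      \<le> (int e - 1) * (int (card (\<Union>F)) + int (card (\<Union>H)))"
    using e by (intro mult_left_mono) auto
  have "int (card (F \<union> H)) + int (card (F \<inter> H)) = int (card F) + int (card H)"
    using card_Un_Int[OF assms(1,2)] by linarith
  then have c: "int (card (F \<union> H)) = int (card F) + int (card H) - int (card (F \<inter> H))" by linarith
  show ?thesis using 1 unfolding excess_def c by (simp add: algebra_simps)
qed

lemma excess_singleton: "card A = r \<Longrightarrow> excess {A} = 0"
  unfolding excess_def by simp

lemma excess_nonzero:
  assumes "2 \<le> card F" "card F < e"
  shows "excess F \<noteq> 0"
proof
  assume "excess F = 0"
  then have "(int (card F) - 1) * P = (int e - 1) * (int (card F) * int r - int (card (\<Union>F)))"
    unfolding excess_def by (simp add: algebra_simps)
  then have "int e - 1 dvd (int (card F) - 1) * P" by simp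
  then have "int e - 1 dvd int (card F) - 1"
    using coprime by (simp add: coprime_dvd_mult_left_iff coprime_iff_gcd_eq_1)
  then show False using assms zdvd_imp_le[of "int e - 1" "int (card F) - 1"] by linarith
qed

lemma excess_e: "card F = e \<Longrightarrow> excess F = (int e - 1) * (int (card (\<Union>F)) - int v)"
  unfolding excess_def by (simp add: algebra_simps P_def)

definition crossing :: "'a set set \<Rightarrow> 'a set set set" where
  "crossing W = {F. F \<subseteq> W \<and> card F = e \<and> card (\<Union>F) \<le> v}"

end

section \<open>Exclusion of short cycles among crossing families\<close>

locale no_dense = exponent +
  fixes W :: "'a set set"
  assumes card_W: "\<And>A. A \<in> W \<Longrightarrow> card A = r"
    \<comment> \<open>The bound 4 * e allows for the union of four crossing families, which arises
      when cycles of length 4 are excluded.\<close>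
    and dense: "\<And>F. F \<subseteq> W \<Longrightarrow> 2 \<le> card F \<Longrightarrow> card F \<le> 4 * e \<Longrightarrow> 0 \<le> excess F"
begin

lemma fin_W: "A \<in> W \<Longrightarrow> finite A"
  using card_W r card.infinite by fastforce

lemma excess_nonneg:
  assumes "F \<subseteq> W" "1 \<le> card F" "card F \<le> 4 * e"
  shows "0 \<le> excess F"
proof (cases "card F = 1")
  case True
  then obtain A where "F = {A}" using card_1_singletonE by blast
  then have "excess F = 0" using excess_singleton[of A] card_W[of A] assms(1) by simp
  then show ?thesis by simp
next
  case False
  then show ?thesis using dense assms by auto
qed

lemma excess_pos: "F \<subseteq> W \<Longrightarrow> 2 \<le> card F \<Longrightarrow> card F < e \<Longrightarrow> 0 < excess F"
  using dense[of F] excess_nonzero[of F] by fastforce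

lemma crossingD:
  assumes "F \<in> crossing W"
  shows "F \<subseteq> W" "card F = e" "finite F" "excess F \<le> 0"
proof -
  show F: "F \<subseteq> W" "card F = e" using assms unfolding crossing_def by auto
  then show "finite F" using e card.infinite by fastforce
  show "excess F \<le> 0" using assms e unfolding excess_e[OF F(2)] crossing_def
    by (intro mult_nonneg_nonpos) auto
qed

text \<open>Otherwise \<open>F \<inter> X\<close> would be a proper part of \<open>F\<close> with at
  least two members, hence of strictly positive excess by coprimality, and submodularity would make
  the excess of \<open>F \<union> X\<close> negative.\<close>

lemma excess_absorb:
  assumes F: "F \<in> crossing W" and X: "X \<subseteq> W" "finite X" "card X \<le> 3 * e" "excess X \<le> 0"
    and two: "A \<in> F" "A \<in> X" "B \<in> F" "B \<in> X" "A \<noteq> B"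
  shows "F \<subseteq> X"
proof (rule ccontr)
  assume "\<not> F \<subseteq> X"
  then have "F \<inter> X \<subset> F" by auto
  then have "card (F \<inter> X) < e" using psubset_card_mono crossingD(2,3)[OF F] by metis
  moreover have "2 \<le> card (F \<inter> X)"
    using two X(2) card_mono[of "F \<inter> X" "{A, B}"] by auto
  ultimately have "0 < excess (F \<inter> X)" using X by (intro excess_pos) auto
  moreover have "excess (F \<union> X) + excess (F \<inter> X) \<le> excess F + excess X"
    using crossingD[OF F] X fin_W by (intro excess_submodular) auto
  moreover have "0 \<le> excess (F \<union> X)"
  proof (rule excess_nonneg)
    show "card (F \<union> X) \<le> 4 * e" using card_Un_le[of F X] crossingD(2)[OF F] X(3) by linarith
    have "card F \<le> card (F \<union> X)" using crossingD(3)[OF F] X(2) by (intro card_mono) auto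
    then show "1 \<le> card (F \<union> X)" using crossingD(2)[OF F] e by linarith
  qed (use crossingD(1)[OF F] X in auto)
  ultimately show False using crossingD(4)[OF F] X(4) by linarith
qed

text \<open>The nonempty intersection has nonnegative excess. Thus a path of crossing families has a
  union of nonpositive excess, to which \<open>excess_absorb\<close> applies.\<close>

lemma excess_join:
  assumes F: "F \<in> crossing W" and X: "X \<subseteq> W" "finite X" "excess X \<le> 0" and A: "A \<in> F" "A \<in> X"
  shows "excess (F \<union> X) \<le> 0"
proof -
  have "excess (F \<union> X) + excess (F \<inter> X) \<le> excess F + excess X"
    using crossingD[OF F] X fin_W by (intro excess_submodular) auto
  moreover have "0 \<le> excess (F \<inter> X)"
  proof (rule excess_nonneg)
    have "card (F \<inter> X) \<le> card F" using crossingD(3)[OF F] by (intro card_mono) auto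
    then show "card (F \<inter> X) \<le> 4 * e" using crossingD(2)[OF F] by simp
    have "F \<inter> X \<noteq> {}" "finite (F \<inter> X)" using A X(2) by auto
    then have "card (F \<inter> X) \<noteq> 0" by simp
    then show "1 \<le> card (F \<inter> X)" by linarith
  qed (use X in auto)
  ultimately show ?thesis using crossingD(4)[OF F] X(3) by linarith
qed

lemma crossing_linear:
  assumes "F \<in> crossing W" "H \<in> crossing W" "A \<in> F" "A \<in> H" "B \<in> F" "B \<in> H" "A \<noteq> B"
  shows "F = H"
proof -
  note H = crossingD[OF assms(2)]
  have "F \<subseteq> H"
    by (rule excess_absorb[OF assms(1) H(1,3) _ H(4) assms(3-7)]) (use H(2) in simp)
  then show ?thesis using card_subset_eq[OF H(3)] H(2) crossingD(2)[OF assms(1)] by simp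
qed

text \<open>\<open>L\<close> is absorbed by \<open>F \<union> H\<close> but meets each of them in
  one member only, by linearity. So |L| <= 2, contradicting e >= 3.\<close>

lemma crossing_triangle:
  assumes "F \<in> crossing W" "H \<in> crossing W" "L \<in> crossing W" "distinct [F, H, L]" "distinct [A, B, C]"
    and inc: "{A, B} \<subseteq> F" "{B, C} \<subseteq> H" "{C, A} \<subseteq> L"
  shows False
proof -
  note F = crossingD[OF assms(1)] and H = crossingD[OF assms(2)] and L = crossingD[OF assms(3)]
  have "excess (F \<union> H) \<le> 0" using inc by (intro excess_join[OF assms(1) H(1,3,4), of B]) auto
  moreover have "card (F \<union> H) \<le> 3 * e" using card_Un_le[of F H] F H by linarith
  ultimately have "L \<subseteq> F \<union> H"
    using inc assms(5) F H by (intro excess_absorb[OF assms(3), of _ C A]) auto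
  moreover have "X = A" if "X \<in> F" "X \<in> L" for X
    using crossing_linear[OF assms(1,3), of X A] that inc assms(4) by auto
  moreover have "X = C" if "X \<in> H" "X \<in> L" for X
    using crossing_linear[OF assms(2,3), of X C] that inc assms(4) by auto
  ultimately have "L \<subseteq> {A, C}" by blast
  then have "card L \<le> card {A, C}" by (intro card_mono) auto
  also have "\<dots> \<le> 2" by (simp add: card_insert_if)
  finally show False using L(2) e by simp
qed

text \<open>\<open>M\<close> is absorbed by the other three families and meets \<open>F\<close> only
  in \<open>A\<close> and \<open>L\<close> only in \<open>D\<close>. A third member \<open>U\<close>
  of \<open>M\<close> therefore lies in \<open>H\<close> and closes the triangle \<open>F\<close>,
  \<open>H\<close>, \<open>M\<close>.\<close>

lemma crossing_quadrangle:
  assumes "F \<in> crossing W" "H \<in> crossing W" "L \<in> crossing W" "M \<in> crossing W"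
    and "distinct [F, H, L, M]" "distinct [A, B, C, D]"
    and inc: "{A, B} \<subseteq> F" "{B, C} \<subseteq> H" "{C, D} \<subseteq> L" "{D, A} \<subseteq> M"
  shows False
proof -
  note F = crossingD[OF assms(1)] and H = crossingD[OF assms(2)] and L = crossingD[OF assms(3)]
    and M = crossingD[OF assms(4)]
  have 1: "excess (H \<union> L) \<le> 0" using inc by (intro excess_join[OF assms(2) L(1,3,4), of C]) auto
  have 2: "excess (F \<union> (H \<union> L)) \<le> 0"
    using inc H(1,3) L(1,3) by (intro excess_join[OF assms(1) _ _ 1, of B]) auto
  have "card (F \<union> (H \<union> L)) \<le> 3 * e"
    using card_Un_le[of F "H \<union> L"] card_Un_le[of H L] F(2) H(2) L(2) by linarith
  then have sub: "M \<subseteq> F \<union> (H \<union> L)"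
    using inc assms(6) F(1,3) H(1,3) L(1,3) 2 by (intro excess_absorb[OF assms(4), of _ D A]) auto
  have "\<not> M \<subseteq> {A, D}"
  proof
    assume "M \<subseteq> {A, D}"
    then have "card M \<le> card {A, D}" by (intro card_mono) auto
    also have "\<dots> \<le> 2" by (simp add: card_insert_if)
    finally show False using M(2) e by simp
  qed
  then obtain U where U: "U \<in> M" "U \<noteq> A" "U \<noteq> D" by auto
  have FM: "X = A" if "X \<in> F" "X \<in> M" for X
    using crossing_linear[OF assms(1,4), of X A] that inc assms(5) by auto
  have LM: "X = D" if "X \<in> L" "X \<in> M" for X
    using crossing_linear[OF assms(3,4), of X D] that inc assms(5) by auto
  have "U \<in> H" using sub U FM LM by auto
  moreover have "U \<noteq> B" using FM U inc by auto
  ultimately show False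
    using U inc assms(5,6) by (intro crossing_triangle[OF assms(1,2,4), of A B U]) auto
qed

lemma uncrowded_crossing: "uncrowded (crossing W)"
  unfolding uncrowded_def
proof (intro conjI ballI allI impI)
  fix F H A B
  assume "F \<in> crossing W" "H \<in> crossing W" "A \<noteq> B \<and> {A, B} \<subseteq> F \<inter> H"
  then show "F = H" using crossing_linear[of F H A B] by simp
next
  fix F H L and A B C :: "'a set"
  assume "F \<in> crossing W" "H \<in> crossing W" "L \<in> crossing W" "distinct [F, H, L] \<and> distinct [A, B, C]"
  then show "\<not> ({A, B} \<subseteq> F \<and> {B, C} \<subseteq> H \<and> {C, A} \<subseteq> L)" using crossing_triangle by metis
next
  fix F H L M and A B C D :: "'a set"
  assume "F \<in> crossing W" "H \<in> crossing W" "L \<in> crossing W" "M \<in> crossing W"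
    "distinct [F, H, L, M] \<and> distinct [A, B, C, D]"
  then show "\<not> ({A, B} \<subseteq> F \<and> {B, C} \<subseteq> H \<and> {C, D} \<subseteq> L \<and> {D, A} \<subseteq> M)"
    using crossing_quadrangle by metis
qed

lemma sparse_crossing:
  assumes "finite W" and deg: "\<And>A. A \<in> W \<Longrightarrow> real (card {F\<in>crossing W. A \<in> F}) \<le> D"
  shows "sparse_hypergraph (e - 1) (\<lambda>j. if j = e - 1 then D else 0) W (crossing W)"
  unfolding sparse_hypergraph_def
proof (intro conjI ballI)
  fix F assume "F \<in> crossing W"
  then show "F \<subseteq> W" "2 \<le> card F" "card F \<le> Suc (e - 1)" using crossingD e by auto
next
  fix A j assume A: "A \<in> W" and j: "j \<in> {1..e - 1}"
  show "real (card {F \<in> crossing W. A \<in> F \<and> card F = Suc j}) \<le> (if j = e - 1 then D else 0)"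
  proof (cases "j = e - 1")
    case True
    then have "{F \<in> crossing W. A \<in> F \<and> card F = Suc j} = {F\<in>crossing W. A \<in> F}"
      using crossingD(2) e by auto
    then show ?thesis using deg[OF A] True by simp
  next
    case False
    then have "{F \<in> crossing W. A \<in> F \<and> card F = Suc j} = {}" using crossingD(2) by auto
    then show ?thesis using False by (simp only: card.empty) simp
  qed
qed (use assms uncrowded_crossing in auto)

end

section \<open>Random families of sets\<close>

lemma card_small_subsets_le:
  assumes "1 \<le> n"
  shows "card {X. X \<subseteq> {1..n} \<and> card X \<le> s} \<le> (s + 1) * n ^ s"
proof -
  have "{X. X \<subseteq> {1..n} \<and> card X \<le> s} = (\<Union>j\<in>{..s}. {X. X \<subseteq> {1..n} \<and> card X = j})" by auto
  also have "card \<dots> \<le> (\<Sum>j\<le>s. card {X. X \<subseteq> {1..n} \<and> card X = j})" by (rule card_UN_le) simp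
  also have "\<dots> = (\<Sum>j\<le>s. n choose j)" by (simp add: n_subsets)
  also have "\<dots> \<le> (\<Sum>j\<le>s. n ^ s)"
  proof (rule sum_mono)
    fix j assume "j \<in> {..s}"
    then have "n ^ j \<le> n ^ s" using assms by (intro power_increasing) auto
    moreover have "n choose j \<le> n ^ j"
      by (cases "j \<le> n") (auto intro: binomial_le_pow simp: binomial_eq_0)
    ultimately show "n choose j \<le> n ^ s" by linarith
  qed
  finally show ?thesis by simp
qed

text \<open>Choose the union X first; the family is then one of at most 2^(2^s) families of subsets
  of X. Only the power n^s matters later.\<close>

lemma card_families_le:
  assumes "1 \<le> n"
  shows "card {F. F \<subseteq> Pow {1..n} \<and> card (\<Union>F) \<le> s} \<le> (s + 1) * 2 ^ 2 ^ s * n ^ s"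
proof -
  let ?X = "{X. X \<subseteq> {1..n} \<and> card X \<le> s}"
  have fin: "finite ?X" by (rule finite_subset[of _ "Pow {1..n}"]) auto
  have "{F. F \<subseteq> Pow {1..n} \<and> card (\<Union>F) \<le> s} \<subseteq> (\<Union>X\<in>?X. Pow (Pow X))"
  proof
    fix F assume "F \<in> {F. F \<subseteq> Pow {1..n} \<and> card (\<Union>F) \<le> s}"
    then have "\<Union>F \<in> ?X" using Union_least[of F "{1..n}"] by blast
    moreover have "F \<in> Pow (Pow (\<Union>F))" by auto
    ultimately show "F \<in> (\<Union>X\<in>?X. Pow (Pow X))" by (rule UN_I)
  qed
  then have "card {F. F \<subseteq> Pow {1..n} \<and> card (\<Union>F) \<le> s} \<le> card (\<Union>X\<in>?X. Pow (Pow X))"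
    using fin by (intro card_mono) (auto intro: finite_subset)
  also have "\<dots> \<le> (\<Sum>X\<in>?X. card (Pow (Pow X)))" using fin by (rule card_UN_le)
  also have "\<dots> \<le> (\<Sum>X\<in>?X. 2 ^ 2 ^ s)"
  proof (rule sum_mono)
    fix X assume X: "X \<in> ?X"
    then have "finite X" by (auto intro: finite_subset)
    then show "card (Pow (Pow X)) \<le> 2 ^ 2 ^ s" using X by (simp add: card_Pow power_increasing)
  qed
  also have "\<dots> = card ?X * 2 ^ 2 ^ s" by simp
  also have "\<dots> \<le> (s + 1) * n ^ s * 2 ^ 2 ^ s" using card_small_subsets_le[OF assms] by (rule mult_right_mono) simp
  finally show ?thesis by (simp add: algebra_simps)
qed

lemma pexp_card: "finite U \<Longrightarrow> pexp (\<lambda>_. p) U (\<lambda>R. real (card R)) = p * real (card U)"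
proof -
  assume fin: "finite U"
  have "pexp (\<lambda>_. p) U (\<lambda>R. real (card R)) = pexp (\<lambda>_. p) U (\<lambda>R. \<Sum>x\<in>U. of_bool (x \<in> R))"
    using fin by (intro pexp_cong) (simp add: Int_absorb1)
  also have "\<dots> = (\<Sum>x\<in>U. p)" unfolding pexp_sum using fin by (intro sum.cong pexp_mem) auto
  finally show ?thesis by (simp add: mult.commute)
qed

lemma pexp_card_contained:
  assumes "finite U" "finite \<F>" "\<And>F. F \<in> \<F> \<Longrightarrow> F \<subseteq> U"
  shows "pexp (\<lambda>_. p) U (\<lambda>R. real (card {F\<in>\<F>. F \<subseteq> R})) = (\<Sum>F\<in>\<F>. p ^ card F)"
proof -
  have "pexp (\<lambda>_. p) U (\<lambda>R. real (card {F\<in>\<F>. F \<subseteq> R})) = pexp (\<lambda>_. p) U (\<lambda>R. \<Sum>F\<in>\<F>. of_bool (F \<subseteq> R))"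
    using assms by (intro pexp_cong) (simp add: Collect_conj_eq)
  also have "\<dots> = (\<Sum>F\<in>\<F>. p ^ card F)"
    unfolding pexp_sum using assms by (intro sum.cong) (auto simp: pexp_subset)
  finally show ?thesis .
qed

lemma sum_card_containing:
  assumes "finite \<F>" "finite R" "\<And>F. F \<in> \<F> \<Longrightarrow> F \<subseteq> R"
  shows "(\<Sum>x\<in>R. card {F\<in>\<F>. x \<in> F}) = (\<Sum>F\<in>\<F>. card F)"
proof -
  have "(\<Sum>x\<in>R. card {F\<in>\<F>. x \<in> F}) = (\<Sum>x\<in>R. \<Sum>F\<in>\<F>. of_bool (x \<in> F))"
    using assms by (simp add: Collect_conj_eq)
  also have "\<dots> = (\<Sum>F\<in>\<F>. \<Sum>x\<in>R. of_bool (x \<in> F))" by (rule sum.swap)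
  also have "\<dots> = (\<Sum>F\<in>\<F>. card F)"
    using assms by (intro sum.cong) (auto simp: Int_absorb1)
  finally show ?thesis .
qed

text \<open>The deletion method: one element of every member of \<open>\<D>\<close> is removed, and all elements of
  large degree in \<open>\<B>\<close>.\<close>
lemma deletion:
  assumes fin: "finite R" "finite \<D>" "finite \<B>" and ne: "{} \<notin> \<D>" and k: "\<And>F. F \<in> \<B> \<Longrightarrow> card F = k"
    and \<Delta>: "\<Delta> > 0"
  shows "\<exists>W\<subseteq>R. (\<forall>F\<in>\<D>. \<not> F \<subseteq> W) \<and> (\<forall>x\<in>W. real (card {F\<in>\<B>. F \<subseteq> W \<and> x \<in> F}) \<le> \<Delta>) \<and>
    real (card W) \<ge> real (card R) - real (card {F\<in>\<D>. F \<subseteq> R}) - real k / \<Delta> * real (card {F\<in>\<B>. F \<subseteq> R})"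
proof -
  define X1 where "X1 = (\<lambda>F. SOME x. x \<in> F) ` {F\<in>\<D>. F \<subseteq> R}"
  define X2 where "X2 = {x\<in>R. real (card {F\<in>\<B>. F \<subseteq> R \<and> x \<in> F}) > \<Delta>}"
  define W where "W = R - X1 - X2"
  have pick: "(SOME x. x \<in> F) \<in> F" if "F \<in> \<D>" for F
  proof -
    have "F \<noteq> {}" using that ne by auto
    then show ?thesis by (simp add: some_in_eq)
  qed
  have finX: "finite X1" "finite X2" unfolding X1_def X2_def using fin by auto
  have c1: "card X1 \<le> card {F\<in>\<D>. F \<subseteq> R}"
    unfolding X1_def using fin by (intro card_image_le) auto
  have "real (card X2) * \<Delta> = (\<Sum>x\<in>X2. \<Delta>)" by simp
  also have "\<dots> \<le> (\<Sum>x\<in>X2. real (card {F\<in>\<B>. F \<subseteq> R \<and> x \<in> F}))"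
    unfolding X2_def by (intro sum_mono) auto
  also have "\<dots> \<le> (\<Sum>x\<in>R. real (card {F\<in>\<B>. F \<subseteq> R \<and> x \<in> F}))"
    using fin unfolding X2_def by (intro sum_mono2) auto
  also have "\<dots> = real (\<Sum>x\<in>R. card {F\<in>{F\<in>\<B>. F \<subseteq> R}. x \<in> F})" by (simp add: conj_assoc)
  also have "(\<Sum>x\<in>R. card {F\<in>{F\<in>\<B>. F \<subseteq> R}. x \<in> F}) = (\<Sum>F\<in>{F\<in>\<B>. F \<subseteq> R}. card F)"
    using fin by (intro sum_card_containing) auto
  also have "\<dots> = k * card {F\<in>\<B>. F \<subseteq> R}" using k by simp
  finally have "real (card X2) \<le> real k / \<Delta> * real (card {F\<in>\<B>. F \<subseteq> R})"
    using \<Delta> by (simp add: field_simps)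
  moreover have "card R \<le> card W + card X1 + card X2"
  proof -
    have "card R \<le> card (W \<union> X1 \<union> X2)"
      using fin finX unfolding W_def by (intro card_mono) auto
    also have "\<dots> \<le> card W + card X1 + card X2"
      using card_Un_le[of "W \<union> X1" X2] card_Un_le[of W X1] by linarith
    finally show ?thesis .
  qed
  ultimately have "real (card W) \<ge> real (card R) - real (card {F\<in>\<D>. F \<subseteq> R}) - real k / \<Delta> * real (card {F\<in>\<B>. F \<subseteq> R})"
    using c1 by linarith
  moreover have "\<not> F \<subseteq> W" if "F \<in> \<D>" for F
  proof
    assume F: "F \<subseteq> W"
    then have "(SOME x. x \<in> F) \<in> X1" using that unfolding X1_def W_def by auto
    then show False using F pick[OF that] unfolding W_def by auto
  qed
  moreover have "real (card {F\<in>\<B>. F \<subseteq> W \<and> x \<in> F}) \<le> \<Delta>" if x: "x \<in> W" for x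
  proof -
    have "card {F\<in>\<B>. F \<subseteq> W \<and> x \<in> F} \<le> card {F\<in>\<B>. F \<subseteq> R \<and> x \<in> F}"
      using fin unfolding W_def by (intro card_mono) auto
    moreover have "real (card {F\<in>\<B>. F \<subseteq> R \<and> x \<in> F}) \<le> \<Delta>" using x unfolding W_def X2_def by auto
    ultimately show ?thesis by linarith
  qed
  ultimately show ?thesis unfolding W_def by (intro exI[of _ "R - X1 - X2"]) auto
qed

section \<open>Sampling r-sets and counting the bad configurations\<close>

context exponent
begin

definition \<alpha> :: real where "\<alpha> = real_of_int P / (real e - 1)"

text \<open>Negative excess gains a factor n^(-1/(e-1)), and oversampling costs n^(m \<epsilon>) for
  m <= 4e sets. Here 4 e \<epsilon> = 1/(2(e-1)), so the gain prevails.\<close>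

definition \<epsilon> :: real where "\<epsilon> = 1 / (8 * real e * (real e - 1))"

definition edges :: "nat \<Rightarrow> nat set set" where "edges n = {A. A \<subseteq> {1..n} \<and> card A = r}"

definition density :: "nat \<Rightarrow> real" where "density n = real n powr (\<alpha> - real r + \<epsilon>)"

definition dense_families :: "nat \<Rightarrow> nat set set set" where
  "dense_families n = {F. F \<subseteq> edges n \<and> 2 \<le> card F \<and> card F \<le> 4 * e \<and> excess F < 0}"

definition C_dense :: real where "C_dense = (\<Sum>s\<le>4 * e * r. real ((s + 1) * 2 ^ 2 ^ s))"

definition C_crossing :: real where "C_crossing = real ((v + 1) * 2 ^ 2 ^ v)"

lemma e_pos: "real e - 1 > 0" using e by simp

lemma \<epsilon>_pos: "\<epsilon> > 0" unfolding \<epsilon>_def using e by simp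

text \<open>This is where v >= r + 1 enters: it leaves space for \<epsilon> below r, so that the
  sampling density is at most 1.\<close>

lemma \<alpha>_le: "\<alpha> \<le> real r - 1 / (real e - 1)"
proof -
  have "P \<le> (int e - 1) * int r - 1" unfolding P_def using v by (simp add: algebra_simps)
  then have "real_of_int P \<le> real_of_int ((int e - 1) * int r - 1)" by (simp only: of_int_le_iff)
  then have "\<alpha> \<le> ((real e - 1) * real r - 1) / (real e - 1)"
    unfolding \<alpha>_def using e_pos by (intro divide_right_mono) auto
  then show ?thesis using e_pos by (simp add: diff_divide_distrib)
qed

lemma \<epsilon>_le: "4 * real e * \<epsilon> \<le> 1 / (real e - 1)"
  unfolding \<epsilon>_def using e e_pos by (simp add: field_simps)

lemma \<epsilon>_le': "\<epsilon> \<le> 1 / (real e - 1)"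
proof -
  have "1 * \<epsilon> \<le> 4 * real e * \<epsilon>" using e \<epsilon>_pos by (intro mult_right_mono) auto
  then show ?thesis using \<epsilon>_le by simp
qed

lemma density_bounds: "1 \<le> n \<Longrightarrow> 0 \<le> density n \<and> density n \<le> 1"
proof -
  assume n: "1 \<le> n"
  have "real n powr (\<alpha> - real r + \<epsilon>) \<le> real n powr 0"
    using n \<alpha>_le \<epsilon>_le' by (intro powr_mono) auto
  then show ?thesis using n unfolding density_def by simp
qed

lemma finite_edges: "finite (edges n)"
  by (rule finite_subset[of _ "Pow {1..n}"]) (auto simp: edges_def)

lemma card_Union_edges: "F \<subseteq> edges n \<Longrightarrow> card (\<Union>F) \<le> card F * r"
proof -
  assume F: "F \<subseteq> edges n"
  have "card (\<Union>F) \<le> (\<Sum>A\<in>F. card A)" by (rule card_Union_le_sum_card)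
  also have "\<dots> = card F * r" using F by (simp add: edges_def subset_iff)
  finally show ?thesis .
qed

lemma density_power: "1 \<le> n \<Longrightarrow> density n ^ m = real n powr (real m * (\<alpha> - real r + \<epsilon>))"
  unfolding density_def by (simp add: powr_powr mult.commute flip: powr_realpow)

text \<open>The excess is an integer, hence at most -1, and this makes the probability of
  \<open>F\<close> at most n^(\<alpha> - s) where s is the size of its union. There are of order n^s
  such families for each of boundedly many s.\<close>

lemma expected_dense:
  assumes n: "1 \<le> n"
  shows "(\<Sum>F\<in>dense_families n. density n ^ card F) \<le> C_dense * real n powr \<alpha>"
proof -
  let ?D = "dense_families n"
  have finD: "finite ?D"
    by (rule finite_subset[of _ "Pow (edges n)"]) (auto simp: dense_families_def finite_edges)
  have le: "density n ^ card F \<le> real n powr (\<alpha> - real (card (\<Union>F)))" if F: "F \<in> ?D" for F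
  proof -
    let ?m = "real (card F)" and ?s = "real (card (\<Union>F))"
    have ex: "excess F \<le> -1" and m: "card F \<le> 4 * e" using F unfolding dense_families_def by auto
    have "real_of_int (excess F) \<le> -1" using ex by linarith
    then have "(real e - 1) * (?s - ?m * real r) + (?m - 1) * real_of_int P \<le> -1"
      unfolding excess_def by simp
    then have "((real e - 1) * (?s - ?m * real r) + (?m - 1) * real_of_int P) / (real e - 1) \<le> -1 / (real e - 1)"
      using e_pos by (intro divide_right_mono) auto
    then have 1: "(?s - ?m * real r) + (?m - 1) * \<alpha> \<le> - (1 / (real e - 1))"
      unfolding \<alpha>_def using e_pos by (simp add: add_divide_distrib)
    have "?m * \<epsilon> \<le> 4 * real e * \<epsilon>" using m \<epsilon>_pos by (intro mult_right_mono) auto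
    then have "?m * \<epsilon> \<le> 1 / (real e - 1)" using \<epsilon>_le by linarith
    then have "?m * (\<alpha> - real r + \<epsilon>) \<le> \<alpha> - ?s" using 1 by (simp add: algebra_simps)
    then show ?thesis unfolding density_power[OF n] using n by (intro powr_mono) auto
  qed
  have "(\<Sum>F\<in>?D. density n ^ card F) \<le> (\<Sum>F\<in>?D. real n powr (\<alpha> - real (card (\<Union>F))))"
    by (rule sum_mono[OF le])
  also have "\<dots> = (\<Sum>s\<in>{..4 * e * r}. \<Sum>F\<in>{F\<in>?D. card (\<Union>F) = s}. real n powr (\<alpha> - real (card (\<Union>F))))"
  proof (rule sum.group[symmetric, OF finD])
    show "(\<lambda>F. card (\<Union>F)) ` ?D \<subseteq> {..4 * e * r}"
    proof
      fix s assume "s \<in> (\<lambda>F. card (\<Union>F)) ` ?D"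
      then obtain F where F: "s = card (\<Union>F)" "F \<subseteq> edges n" "card F \<le> 4 * e"
        unfolding dense_families_def by auto
      have "card F * r \<le> 4 * e * r" using F(3) by (rule mult_right_mono) simp
      then show "s \<in> {..4 * e * r}"
        unfolding F(1) atMost_iff by (rule order_trans[OF card_Union_edges[OF F(2)]])
    qed
  qed simp
  also have "\<dots> \<le> (\<Sum>s\<in>{..4 * e * r}. real ((s + 1) * 2 ^ 2 ^ s) * real n powr \<alpha>)"
  proof (rule sum_mono)
    fix s
    have "(\<Sum>F\<in>{F\<in>?D. card (\<Union>F) = s}. real n powr (\<alpha> - real (card (\<Union>F))))
      = real (card {F\<in>?D. card (\<Union>F) = s}) * real n powr (\<alpha> - real s)" by simp
    also have "\<dots> \<le> real ((s + 1) * 2 ^ 2 ^ s * n ^ s) * real n powr (\<alpha> - real s)"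
    proof (intro mult_right_mono)
      have "{F\<in>?D. card (\<Union>F) = s} \<subseteq> {F. F \<subseteq> Pow {1..n} \<and> card (\<Union>F) \<le> s}"
        unfolding dense_families_def edges_def by blast
      then have "card {F\<in>?D. card (\<Union>F) = s} \<le> card {F. F \<subseteq> Pow {1..n} \<and> card (\<Union>F) \<le> s}"
        by (intro card_mono) auto
      then show "real (card {F\<in>?D. card (\<Union>F) = s}) \<le> real ((s + 1) * 2 ^ 2 ^ s * n ^ s)"
        using card_families_le[OF n, of s] by (simp only: of_nat_le_iff)
    qed simp
    also have "\<dots> = real ((s + 1) * 2 ^ 2 ^ s) * (real n powr real s * real n powr (\<alpha> - real s))"
      using n by (simp add: powr_realpow)
    also have "real n powr real s * real n powr (\<alpha> - real s) = real n powr \<alpha>"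
      by (simp flip: powr_add)
    finally show "(\<Sum>F\<in>{F\<in>?D. card (\<Union>F) = s}. real n powr (\<alpha> - real (card (\<Union>F))))
      \<le> real ((s + 1) * 2 ^ 2 ^ s) * real n powr \<alpha>" .
  qed
  also have "\<dots> = C_dense * real n powr \<alpha>" unfolding C_dense_def by (simp add: sum_distrib_right)
  finally show ?thesis .
qed

text \<open>Since (e - 1) \<alpha> = er - v, the exponent v + e (\<alpha> - r + \<epsilon>)
  collapses to \<alpha> + e \<epsilon>.\<close>

lemma expected_crossing:
  assumes n: "1 \<le> n"
  shows "(\<Sum>F\<in>crossing (edges n). density n ^ card F) \<le> C_crossing * real n powr (\<alpha> + real e * \<epsilon>)"
proof -
  have "(\<Sum>F\<in>crossing (edges n). density n ^ card F) = (\<Sum>F\<in>crossing (edges n). density n ^ e)"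
    by (intro sum.cong) (auto simp: crossing_def)
  also have "\<dots> = real (card (crossing (edges n))) * real n powr (real e * (\<alpha> - real r + \<epsilon>))"
    by (simp add: density_power[OF n])
  also have "\<dots> \<le> real ((v + 1) * 2 ^ 2 ^ v * n ^ v) * real n powr (real e * (\<alpha> - real r + \<epsilon>))"
  proof (intro mult_right_mono)
    have "crossing (edges n) \<subseteq> {F. F \<subseteq> Pow {1..n} \<and> card (\<Union>F) \<le> v}"
      unfolding crossing_def edges_def by blast
    then have "card (crossing (edges n)) \<le> card {F. F \<subseteq> Pow {1..n} \<and> card (\<Union>F) \<le> v}"
      by (intro card_mono) auto
    then show "real (card (crossing (edges n))) \<le> real ((v + 1) * 2 ^ 2 ^ v * n ^ v)"
      using card_families_le[OF n, of v] by (simp only: of_nat_le_iff)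
  qed simp
  also have "\<dots> = C_crossing * (real n powr real v * real n powr (real e * (\<alpha> - real r + \<epsilon>)))"
    unfolding C_crossing_def using n by (simp add: powr_realpow)
  also have "real n powr real v * real n powr (real e * (\<alpha> - real r + \<epsilon>)) = real n powr (\<alpha> + real e * \<epsilon>)"
  proof -
    have "(real e - 1) * \<alpha> = real_of_int P" unfolding \<alpha>_def using e_pos by simp
    also have "\<dots> = real e * real r - real v" unfolding P_def by simp
    finally have "(real e - 1) * \<alpha> = real e * real r - real v" .
    then have "real v + real e * (\<alpha> - real r + \<epsilon>) = \<alpha> + real e * \<epsilon>" by (simp add: algebra_simps)
    then show ?thesis by (simp flip: powr_add)
  qed
  finally show ?thesis .
qed

text \<open>Size and both deletion costs enter one linear expression, so a single sample is good in
  all respects at once.\<close>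

lemma random_family:
  assumes n: "1 \<le> n" "r \<le> n" and \<Delta>: "\<Delta> > 0"
  shows "\<exists>W\<subseteq>edges n. (\<forall>F\<in>dense_families n. \<not> F \<subseteq> W) \<and>
    (\<forall>A\<in>W. real (card {F\<in>crossing W. A \<in> F}) \<le> \<Delta>) \<and>
    real (card W) \<ge> real n powr (\<alpha> + \<epsilon>) / real r ^ r - C_dense * real n powr \<alpha>
      - real e / \<Delta> * (C_crossing * real n powr (\<alpha> + real e * \<epsilon>))"
proof -
  let ?U = "edges n" and ?D = "dense_families n" and ?B = "crossing (edges n)"
  let ?F = "\<lambda>R. real (card R) - real (card {F\<in>?D. F \<subseteq> R}) - real e / \<Delta> * real (card {F\<in>?B. F \<subseteq> R})"
  have finD: "finite ?D" "finite ?B"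
    by (rule finite_subset[of _ "Pow ?U"]; auto simp: dense_families_def crossing_def finite_edges)+
  have "pexp (\<lambda>_. density n) ?U ?F = density n * real (card ?U)
      - (\<Sum>F\<in>?D. density n ^ card F) - real e / \<Delta> * (\<Sum>F\<in>?B. density n ^ card F)"
    unfolding pexp_diff pexp_cmult pexp_card[OF finite_edges]
    using finD finite_edges
    by (subst (1 2) pexp_card_contained) (auto simp: dense_families_def crossing_def)
  moreover have "density n * real (card ?U) \<ge> real n powr (\<alpha> + \<epsilon>) / real r ^ r"
  proof -
    have "(real n / real r) ^ r \<le> real (n choose r)" using n(2) by (rule binomial_ge_n_over_k_pow_k)
    also have "n choose r = card ?U" unfolding edges_def by (simp add: n_subsets)
    finally have "density n * (real n / real r) ^ r \<le> density n * real (card ?U)"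
      using density_bounds[OF n(1)] by (intro mult_left_mono) auto
    moreover have "density n * real n powr real r = real n powr (\<alpha> + \<epsilon>)"
      unfolding density_def by (simp flip: powr_add)
    ultimately show ?thesis using n by (simp add: power_divide powr_realpow)
  qed
  moreover have "real e / \<Delta> * (\<Sum>F\<in>?B. density n ^ card F)
      \<le> real e / \<Delta> * (C_crossing * real n powr (\<alpha> + real e * \<epsilon>))"
    using expected_crossing[OF n(1)] \<Delta> by (intro mult_left_mono) auto
  ultimately have "pexp (\<lambda>_. density n) ?U ?F \<ge> real n powr (\<alpha> + \<epsilon>) / real r ^ r
      - C_dense * real n powr \<alpha> - real e / \<Delta> * (C_crossing * real n powr (\<alpha> + real e * \<epsilon>))"
    using expected_dense[OF n(1)] by linarith
  then obtain R where R: "R \<subseteq> ?U" "?F R \<ge> real n powr (\<alpha> + \<epsilon>) / real r ^ r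
      - C_dense * real n powr \<alpha> - real e / \<Delta> * (C_crossing * real n powr (\<alpha> + real e * \<epsilon>))"
    using pexp_exists[OF finite_edges, of n "\<lambda>_. density n"] density_bounds[OF n(1)] by meson
  have "finite R" using R(1) finite_edges finite_subset by auto
  moreover have "{} \<notin> ?D" unfolding dense_families_def by auto
  moreover have "card F = e" if "F \<in> ?B" for F using that unfolding crossing_def by auto
  ultimately obtain W where W: "W \<subseteq> R" "\<forall>F\<in>?D. \<not> F \<subseteq> W"
      "\<forall>A\<in>W. real (card {F\<in>?B. F \<subseteq> W \<and> A \<in> F}) \<le> \<Delta>" "real (card W) \<ge> ?F R"
    using deletion[of R ?D ?B e \<Delta>] finD \<Delta> by blast
  have "{F\<in>?B. F \<subseteq> W \<and> A \<in> F} = {F\<in>crossing W. A \<in> F}" for A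
    using W(1) R(1) unfolding crossing_def by auto
  then show ?thesis using W R by (intro exI[of _ W]) auto
qed

theorem sparse_family:
  obtains c n0 where "c > 0" "\<And>n. n \<ge> n0 \<Longrightarrow>
    \<exists>H\<subseteq>edges n. real (card H) \<ge> c * real n powr \<alpha> * ln (real n) powr (1 / (real e - 1)) \<and>
    (\<forall>F\<subseteq>H. card F = e \<longrightarrow> v < card (\<Union>F)) \<and> (\<forall>F\<subseteq>H. 2 \<le> card F \<and> card F < e \<longrightarrow> 0 < excess F)"
proof -
  have e1: "1 \<le> e - 1" and re1: "real (e - 1) = real e - 1" using e by auto
  obtain c d0 where c: "c > 0" and indep: "\<And>d (V :: nat set set) E. d \<ge> d0 \<Longrightarrow>
      sparse_hypergraph (e - 1) (\<lambda>j. if j = e - 1 then d ^ (e - 1) else 0) V E \<Longrightarrow>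
      \<exists>J\<subseteq>V. indep_set E J \<and> real (card J) \<ge> c * real (card V) * (root (e - 1) (ln d) / d)"
    using uncrowded_indep_set[OF e1] by metis
  define \<kappa> where "\<kappa> = 1 / real r ^ r"
  \<comment> \<open>The degree limit is d^(e-1) with d = D n^\<epsilon>. As D^(e-1) >= D, deleting
    sets of large degree costs at most a quarter of \<kappa> n^(\<alpha> + \<epsilon>).\<close>
  define D where "D = max 1 (4 * real e * C_crossing / \<kappa>)"
  have \<kappa>: "\<kappa> > 0" unfolding \<kappa>_def using r by simp
  have D1: "D \<ge> 1" and D2: "D \<ge> 4 * real e * C_crossing / \<kappa>" unfolding D_def by auto
  have "filterlim (\<lambda>n. real n powr \<epsilon>) at_top sequentially"
    using \<epsilon>_pos by real_asymp
  \<comment> \<open>For such n the dense families, of order n^\<alpha> in expectation, cost at most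
    another quarter, and d reaches \<open>d0\<close>.\<close>
  then have "\<forall>\<^sub>F n in sequentially. real n powr \<epsilon> \<ge> max d0 (4 * C_dense / \<kappa>)"
    unfolding filterlim_at_top by blast
  then obtain n1 where n1: "\<And>n. n \<ge> n1 \<Longrightarrow> real n powr \<epsilon> \<ge> max d0 (4 * C_dense / \<kappa>)"
    unfolding eventually_sequentially by blast
  have main: "\<exists>H\<subseteq>edges n. real (card H) \<ge> c * \<kappa> / (2 * D) * root (e - 1) \<epsilon> * real n powr \<alpha> * ln (real n) powr (1 / (real e - 1)) \<and>
    (\<forall>F\<subseteq>H. card F = e \<longrightarrow> v < card (\<Union>F)) \<and> (\<forall>F\<subseteq>H. 2 \<le> card F \<and> card F < e \<longrightarrow> 0 < excess F)"
    if n: "n \<ge> max n1 (max r 3)" for n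
  proof -
    define x where "x = real n powr \<epsilon>"
    have n': "1 \<le> n" "r \<le> n" "3 \<le> n" and x0: "x > 0" using n unfolding x_def by auto
    have x: "x \<ge> d0" "x \<ge> 4 * C_dense / \<kappa>" using n1[of n] n unfolding x_def by auto
    define d where "d = D * x"
    have d_pos: "d > 0" unfolding d_def using D1 x0 by simp
    have dx: "d \<ge> x" unfolding d_def using mult_right_mono[OF D1, of x] x0 by simp
    define N where "N = real n powr (\<alpha> + \<epsilon>)"
    have N: "N = real n powr \<alpha> * x" unfolding N_def x_def by (rule powr_add)
    have N0: "N > 0" unfolding N_def using n' by simp
    have "C_dense * real n powr \<alpha> \<le> \<kappa> / 4 * N"
    proof -
      have "C_dense \<le> \<kappa> / 4 * x" using x(2) \<kappa> by (simp add: field_simps)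
      then have "C_dense * real n powr \<alpha> \<le> \<kappa> / 4 * x * real n powr \<alpha>" by (rule mult_right_mono) simp
      then show ?thesis unfolding N by (simp add: mult_ac)
    qed
    moreover have "real e / d ^ (e - 1) * (C_crossing * real n powr (\<alpha> + real e * \<epsilon>)) \<le> \<kappa> / 4 * N"
    proof -
      have "D ^ 1 \<le> D ^ (e - 1)" using D1 e1 by (intro power_increasing) auto
      then have "4 * real e * C_crossing / \<kappa> \<le> D ^ (e - 1)" using D2 by simp
      then have *: "real e * C_crossing \<le> \<kappa> / 4 * D ^ (e - 1)" using \<kappa> by (simp add: field_simps)
      have "real n powr (\<alpha> + real e * \<epsilon>) = N * x ^ (e - 1)"
      proof -
        have "x ^ (e - 1) = real n powr (real (e - 1) * \<epsilon>)"
          using x0 unfolding x_def by (simp add: powr_powr mult.commute flip: powr_realpow)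
        then show ?thesis unfolding N_def re1 by (simp add: algebra_simps flip: powr_add)
      qed
      then have "real e / d ^ (e - 1) * (C_crossing * real n powr (\<alpha> + real e * \<epsilon>))
        = real e * C_crossing / D ^ (e - 1) * N"
        using x0 unfolding d_def by (simp add: power_mult_distrib field_simps)
      also have "\<dots> \<le> \<kappa> / 4 * N"
        using * D1 N0 by (intro mult_right_mono) (auto simp: pos_divide_le_eq)
      finally show ?thesis .
    qed
    moreover obtain W where W: "W \<subseteq> edges n" "\<forall>F\<in>dense_families n. \<not> F \<subseteq> W"
      "\<forall>A\<in>W. real (card {F\<in>crossing W. A \<in> F}) \<le> d ^ (e - 1)"
      "real (card W) \<ge> N / real r ^ r - C_dense * real n powr \<alpha>
        - real e / d ^ (e - 1) * (C_crossing * real n powr (\<alpha> + real e * \<epsilon>))"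
      using random_family[OF n'(1,2), of "d ^ (e - 1)"] d_pos unfolding N_def by auto
    moreover have "N / real r ^ r = \<kappa> * N" unfolding \<kappa>_def by simp
    ultimately have cardW: "real (card W) \<ge> \<kappa> / 2 * N" by linarith
    interpret no_dense r e v P W
    proof unfold_locales
      show "card A = r" if "A \<in> W" for A using that W(1) unfolding edges_def by auto
      show "0 \<le> excess F" if "F \<subseteq> W" "2 \<le> card F" "card F \<le> 4 * e" for F
      proof (rule ccontr)
        assume "\<not> 0 \<le> excess F"
        then have "F \<in> dense_families n" using that W(1) unfolding dense_families_def by auto
        then show False using W(2) that(1) by blast
      qed
    qed
    have "finite W" using W(1) finite_edges finite_subset by auto
    then have "sparse_hypergraph (e - 1) (\<lambda>j. if j = e - 1 then d ^ (e - 1) else 0) W (crossing W)"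
      using W(3) by (intro sparse_crossing) auto
    then obtain J where J: "J \<subseteq> W" "indep_set (crossing W) J"
      "real (card J) \<ge> c * real (card W) * (root (e - 1) (ln d) / d)"
      using indep[of d] dx x by force
    have "\<epsilon> * ln (real n) \<le> ln d"
    proof -
      have "\<epsilon> * ln (real n) = ln x" unfolding x_def using n' by (simp add: ln_powr)
      also have "\<dots> \<le> ln d" using dx x0 by simp
      finally show ?thesis .
    qed
    then have "root (e - 1) (\<epsilon> * ln (real n)) \<le> root (e - 1) (ln d)"
      using e1 by (intro real_root_le_mono) auto
    then have root: "root (e - 1) \<epsilon> * root (e - 1) (ln (real n)) \<le> root (e - 1) (ln d)"
      by (simp only: real_root_mult)
    have ln_pos: "0 < ln (real n)" using n' by simp
    have nn: "0 \<le> root (e - 1) \<epsilon> * root (e - 1) (ln (real n))"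
      using \<epsilon>_pos ln_pos by (intro mult_nonneg_nonneg real_root_ge_zero) auto
    have "c * (\<kappa> / 2 * N) * (root (e - 1) \<epsilon> * root (e - 1) (ln (real n)) / d) \<le>
        c * real (card W) * (root (e - 1) (ln d) / d)"
      using cardW c root nn d_pos \<kappa> N0 by (intro mult_mono divide_right_mono) auto
    also have "\<dots> \<le> real (card J)" by (rule J(3))
    also have "root (e - 1) (ln (real n)) = ln (real n) powr (1 / (real e - 1))"
      using root_powr_inverse[of "e - 1" "ln (real n)"] e1 ln_pos re1 by simp
    \<comment> \<open>N / d = n^\<alpha> / D: the oversampling cancels, and only log d >= \<epsilon>
      log n remains of it.\<close>
    finally have "c * \<kappa> / (2 * D) * root (e - 1) \<epsilon> * real n powr \<alpha> * ln (real n) powr (1 / (real e - 1)) \<le> real (card J)"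
      using x0 D1 unfolding N d_def by (simp add: field_simps)
    moreover have "v < card (\<Union>F)" if "F \<subseteq> J" "card F = e" for F
    proof (rule ccontr)
      assume "\<not> v < card (\<Union>F)"
      then have "F \<in> crossing W" using that J(1) unfolding crossing_def by auto
      then show False using J(2) that(1) unfolding indep_set_def by blast
    qed
    moreover have "0 < excess F" if "F \<subseteq> J" "2 \<le> card F" "card F < e" for F
      using that J(1) by (intro excess_pos) auto
    ultimately show ?thesis using J(1) W(1) by (intro exI[of _ J]) auto
  qed
  have "c * \<kappa> / (2 * D) * root (e - 1) \<epsilon> > 0" using c \<kappa> D1 \<epsilon>_pos e1 by simp
  then show ?thesis using main by (rule that)
qed

end

theorem mainTheorem1:
  fixes r e v :: nat
  assumes "r \<ge> 3" and "e \<ge> 3" and "v \<ge> r + 1"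
    and "gcd (int e - 1) (int e * int r - int v) = 1"
  shows "\<exists>c::real. c > 0 \<and> (\<exists>n0::nat. \<forall>n\<ge>n0. \<exists>H.
           r_graph_on r n H \<and>
           real (card H) \<ge> c * real n powr ((real e * real r - real v) / (real e - 1))
                              * ln (real n) powr (1 / (real e - 1)) \<and>
           (\<forall>i. 2 \<le> i \<and> i \<le> e \<longrightarrow>
              G_free H (int i * int r - \<lceil>real (i - 1) * (real e * real r - real v) / (real e - 1)\<rceil>) i))"
proof -
  let ?P = "int e * int r - int v"
  \<comment> \<open>The gcd condition does not force er > v. For er < v the claimed size tends to 0
    and a single edge suffices.\<close>
  consider "?P > 0" | "?P < 0" | "?P = 0" by linarith
  then show ?thesis
  proof cases
    case 1
    interpret exponent r e v ?P
      using assms 1 by unfold_locales auto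
    have \<alpha>: "(real e * real r - real v) / (real e - 1) = \<alpha>" unfolding \<alpha>_def by simp
    have free: "G_free H (int i * int r - \<lceil>real (i - 1) * (real e * real r - real v) / (real e - 1)\<rceil>) i"
      if H: "\<forall>F\<subseteq>H. card F = e \<longrightarrow> v < card (\<Union>F)" "\<forall>F\<subseteq>H. 2 \<le> card F \<and> card F < e \<longrightarrow> 0 < excess F"
        and i: "2 \<le> i" "i \<le> e" for H i
      unfolding G_free_def
    proof (intro allI impI)
      fix F assume F: "F \<subseteq> H \<and> card F = i"
      have "real_of_int (int i * int r - int (card (\<Union>F))) < real (i - 1) * (real e * real r - real v) / (real e - 1)"
      proof (cases "i = e")
        case True
        then have "v < card (\<Union>F)" using H(1) F by auto
        then have "real v < real (card (\<Union>F))" by simp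
        moreover have "real (i - 1) = real e - 1" using True e by simp
        ultimately show ?thesis using True e_pos by simp
      next
        case False
        then have "0 < excess F" using H(2) F i by auto
        then have "0 < real_of_int (excess F)" by simp
        also have "real_of_int (excess F) = (real e - 1) * (real (card (\<Union>F)) - real (card F) * real r)
            + (real (card F) - 1) * (real e * real r - real v)"
          unfolding excess_def by simp
        also have "card F = i" using F by simp
        also have "real i - 1 = real (i - 1)" using i by simp
        finally have "0 < (real e - 1) * (real (card (\<Union>F)) - real i * real r) + real (i - 1) * (real e * real r - real v)" .
        then show ?thesis by (subst pos_less_divide_eq[OF e_pos]) (simp add: algebra_simps)
      qed
      \<comment> \<open>The left-hand side is an integer, so the strict inequality passes to the
        ceiling.\<close>
      then have "int i * int r - int (card (\<Union>F)) < \<lceil>real (i - 1) * (real e * real r - real v) / (real e - 1)\<rceil>"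
        by (simp only: less_ceiling_iff)
      then show "int i * int r - \<lceil>real (i - 1) * (real e * real r - real v) / (real e - 1)\<rceil> + 1 \<le> int (card (\<Union>F))"
        by linarith
    qed
    obtain c n0 where c: "c > 0" and fam: "\<And>n. n \<ge> n0 \<Longrightarrow>
      \<exists>H\<subseteq>edges n. real (card H) \<ge> c * real n powr \<alpha> * ln (real n) powr (1 / (real e - 1)) \<and>
      (\<forall>F\<subseteq>H. card F = e \<longrightarrow> v < card (\<Union>F)) \<and> (\<forall>F\<subseteq>H. 2 \<le> card F \<and> card F < e \<longrightarrow> 0 < excess F)"
      by (rule sparse_family, rule that)
    show ?thesis
    proof (intro exI[of _ c] exI[of _ n0] conjI allI impI c)
      fix n assume "n \<ge> n0"
      from fam[OF this] obtain H where H: "H \<subseteq> edges n"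
        "real (card H) \<ge> c * real n powr \<alpha> * ln (real n) powr (1 / (real e - 1))"
        "\<forall>F\<subseteq>H. card F = e \<longrightarrow> v < card (\<Union>F)" "\<forall>F\<subseteq>H. 2 \<le> card F \<and> card F < e \<longrightarrow> 0 < excess F"
        by (elim exE conjE)
      have "r_graph_on r n H" using H(1) unfolding r_graph_on_def edges_def .
      then show "\<exists>H. r_graph_on r n H \<and>
           real (card H) \<ge> c * real n powr ((real e * real r - real v) / (real e - 1))
                              * ln (real n) powr (1 / (real e - 1)) \<and>
           (\<forall>i. 2 \<le> i \<and> i \<le> e \<longrightarrow>
              G_free H (int i * int r - \<lceil>real (i - 1) * (real e * real r - real v) / (real e - 1)\<rceil>) i)"
        using H(2)[folded \<alpha>] free[OF H(3,4)] by (intro exI[of _ H] conjI allI impI) simp_all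
    qed
  next
    case 2
    define a where "a = (real v - real e * real r) / (real e - 1)"
    have "int (e * r) < int v" using 2 by simp
    then have "real (e * r) < real v" by (simp only: of_nat_less_iff)
    then have "real e * real r < real v" by simp
    then have a: "a > 0" unfolding a_def using assms by simp
    define b where "b = 1 / (real e - 1)"
    have "((\<lambda>n. real n powr (- a) * ln (real n) powr b) \<longlongrightarrow> 0) sequentially"
      using a by real_asymp
    then have "\<forall>\<^sub>F n in sequentially. real n powr (- a) * ln (real n) powr b < 1"
      by (rule order_tendstoD) simp
    then obtain n1 where n1: "\<And>n. n \<ge> n1 \<Longrightarrow> real n powr (- a) * ln (real n) powr b < 1"
      unfolding eventually_sequentially by blast
    have a': "(real e * real r - real v) / (real e - 1) = - a" unfolding a_def by (simp only: minus_divide_left minus_diff_eq)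
    have "\<exists>H. r_graph_on r n H \<and>
           real (card H) \<ge> 1 * real n powr ((real e * real r - real v) / (real e - 1))
                              * ln (real n) powr (1 / (real e - 1)) \<and>
           (\<forall>i. 2 \<le> i \<and> i \<le> e \<longrightarrow>
              G_free H (int i * int r - \<lceil>real (i - 1) * (real e * real r - real v) / (real e - 1)\<rceil>) i)"
      if "n \<ge> max n1 r" for n
    proof (intro exI[of _ "{{1..r}}"] conjI allI impI)
      show "r_graph_on r n {{1..r}}" using that unfolding r_graph_on_def by auto
      show "1 * real n powr ((real e * real r - real v) / (real e - 1)) * ln (real n) powr (1 / (real e - 1))
          \<le> real (card {{1..r}})"
        using n1[of n] that unfolding a' b_def by simp
      fix i assume i: "2 \<le> i \<and> i \<le> e"
      have "card F \<noteq> i" if "F \<subseteq> {{1..r}}" for F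
        using card_mono[OF _ that] i by simp
      then show "G_free {{1..r}} (int i * int r - \<lceil>real (i - 1) * (real e * real r - real v) / (real e - 1)\<rceil>) i"
        unfolding G_free_def by blast
    qed
    then show ?thesis by (intro exI[of _ "1::real"] exI[of _ "max n1 r"] conjI allI impI) simp_all
  next
    case 3
    \<comment> \<open>Here the gcd would be e - 1 >= 2.\<close>
    then show ?thesis using assms by simp
  qed
qed

end
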